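(* Let $\hbar>0$, let $A$ be a real symmetric positive definite $n\times n$ matrix, let $X=\{x\in\mathbb{R}^n_x: Ax\cdot x\leq\hbar\}$, and let $X^{\hbar}=\{p\in\mathbb{R}^n_p: A^{-1}p\cdot p\leq\hbar\}$ be its quantum polar dual. (i) The product $X\times X^{\hbar}$ contains exactly one quantum blob $\Omega=S(\mathcal{B}^{2n}(\sqrt{\hbar}))$, $S\in\mathrm{Sp}(n)$, with orthogonal projections $X$ on $\mathbb{R}^n_x$ and $X^{\hbar}$ on $\mathbb{R}^n_p$; moreover that quantum blob is the ellipsoid with the largest volume inscribed in the convex set $X\times X^{\hbar}$. (ii) $\Omega$ is the covariance ellipsoid of the pure Gaussian state $$\psi(x)=\left(\tfrac{1}{2\pi}\right)^{n/4}(\det\Sigma_{XX})^{-1/4}e^{-\frac14\Sigma_{XX}^{-1}x\cdot x},\qquad \Sigma_{XX}=\frac{\hbar}{2}A^{-1}.$$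
   Context: Phase space is $\mathbb{R}^{2n}=\mathbb{R}^n_x\times\mathbb{R}^n_p$ with points $z=(x,p)$; the orthogonal projections are $(x,p)\mapsto x$ and $(x,p)\mapsto p$. $\mathcal{B}^{2n}(r)$ is the closed Euclidean ball of radius $r$ centered at $0$ in $\mathbb{R}^{2n}$. $\mathrm{Sp}(n)$ is the group of real $2n\times 2n$ matrices $S$ with $S^TJS=J$, where $J=\begin{pmatrix}0&I_{n\times n}\\-I_{n\times n}&0\end{pmatrix}$. A quantum blob is a set of the form $S(\mathcal{B}^{2n}(\sqrt{\hbar}))$ with $S\in\mathrm{Sp}(n)$. The polar dual of a convex body $X\subset\mathbb{R}^n_x$ containing $0$ in its interior is $X^{\hbar}=\{p\in\mathbb{R}^n_p: p\cdot x\leq\hbar\text{ for all }x\in X\}$. For $\psi\in L^2(\mathbb{R}^n)$ the Wigner transform is $W\psi(x,p)=\left(\frac{1}{2\pi\hbar}\right)^n\int_{\mathbb{R}^n} e^{-\frac{i}{\hbar}p\cdot y}\psi(x+\frac12 y)\overline{\psi(x-\frac12 y)}\,dy$. For a normalized $\psi$ whose Wigner transform has finite second moments and vanishing first moments, the covariance matrix is $\Sigma=\int_{\mathbb{R}^{2n}} zz^T\,W\psi(z)\,dz$, and the covariance ellipsoid of the state $\psi$ is $\{z:\frac12\Sigma^{-1}z\cdot z\leq 1\}$. *)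

theory Defs
  imports "HOL-Analysis.Analysis"
begin

definition positive_definite :: "real^'m^'m \<Rightarrow> bool" where
  "positive_definite A \<longleftrightarrow> transpose A = A \<and> (\<forall>x. x \<noteq> 0 \<longrightarrow> (A *v x) \<bullet> x > 0)"

text \<open>Phase space of dimension \<open>2 n\<close>, with \<open>n = CARD('n)\<close>, is the Euclidean space
  \<^typ>\<open>real^('n + 'n)\<close>: the coordinates \<open>Inl i\<close> are the positions \<open>x\<^sub>i\<close>, the coordinates
  \<open>Inr i\<close> the momenta \<open>p\<^sub>i\<close>.\<close>

definition pos_proj :: "real^('n::finite + 'n) \<Rightarrow> real^'n" where
  "pos_proj z = (\<chi> i. z $ Inl i)"

definition mom_proj :: "real^('n::finite + 'n) \<Rightarrow> real^'n" where
  "mom_proj z = (\<chi> i. z $ Inr i)"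

definition phase_product :: "(real^'n::finite) set \<Rightarrow> (real^'n) set \<Rightarrow> (real^('n + 'n)) set" where
  "phase_product X P = {z. pos_proj z \<in> X \<and> mom_proj z \<in> P}"

definition symp_J :: "real^('n::finite + 'n)^('n + 'n)" where
  "symp_J = (\<chi> i j.
     case (i, j) of
       (Inl a, Inr b) \<Rightarrow> if a = b then 1 else 0
     | (Inr a, Inl b) \<Rightarrow> if a = b then -1 else 0
     | _ \<Rightarrow> 0)"

definition Sp :: "(real^('n::finite + 'n)^('n + 'n)) set" where
  "Sp = {S. transpose S ** symp_J ** S = symp_J}"

definition quantum_blob :: "real \<Rightarrow> (real^('n::finite + 'n)) set \<Rightarrow> bool" where
  "quantum_blob hbar \<Omega> \<longleftrightarrow> (\<exists>S\<in>Sp. \<Omega> = (\<lambda>z. S *v z) ` cball 0 (sqrt hbar))"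

definition polar_dual :: "real \<Rightarrow> (real^'n::finite) set \<Rightarrow> (real^'n) set" where
  "polar_dual hbar X = {p. \<forall>x\<in>X. p \<bullet> x \<le> hbar}"

text \<open>Nondegenerate ellipsoids with an arbitrary centre \<open>c\<close>.\<close>

definition ellipsoid :: "(real^'m::finite) set \<Rightarrow> bool" where
  "ellipsoid E \<longleftrightarrow> (\<exists>(M :: real^'m^'m) c. invertible M \<and> E = (\<lambda>z. c + M *v z) ` cball 0 1)"

definition largest_inscribed_ellipsoid :: "(real^'m::finite) set \<Rightarrow> (real^'m) set \<Rightarrow> bool" where
  "largest_inscribed_ellipsoid K E \<longleftrightarrow>
     ellipsoid E \<and> E \<subseteq> K \<and>
     (\<forall>E'. ellipsoid E' \<and> E' \<subseteq> K \<and> E' \<noteq> E \<longrightarrow> measure lebesgue E' < measure lebesgue E)"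

definition square_integrable :: "(real^'n::finite \<Rightarrow> complex) \<Rightarrow> bool" where
  "square_integrable \<psi> \<longleftrightarrow>
     \<psi> \<in> borel_measurable lebesgue \<and> integrable lebesgue (\<lambda>x. (norm (\<psi> x))\<^sup>2)"

definition wigner :: "real \<Rightarrow> (real^'n::finite \<Rightarrow> complex) \<Rightarrow> real^('n + 'n) \<Rightarrow> complex" where
  "wigner hbar \<psi> z =
     complex_of_real ((1 / (2 * pi * hbar)) ^ CARD('n)) *
     (LINT y|lebesgue.
        exp (- (\<i> / complex_of_real hbar) * complex_of_real (mom_proj z \<bullet> y)) *
        \<psi> (pos_proj z + (1/2) *\<^sub>R y) * cnj (\<psi> (pos_proj z - (1/2) *\<^sub>R y)))"

text \<open>Normalized square-integrable states whose Wigner transform has finite second moments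
  and vanishing first moments.\<close>

definition centered_state :: "real \<Rightarrow> (real^'n::finite \<Rightarrow> complex) \<Rightarrow> bool" where
  "centered_state hbar \<psi> \<longleftrightarrow>
     square_integrable \<psi> \<and>
     (LINT x|lebesgue. (norm (\<psi> x))\<^sup>2) = 1 \<and>
     integrable lebesgue (\<lambda>z. (1 + (norm z)\<^sup>2) *\<^sub>R wigner hbar \<psi> z) \<and>
     (\<forall>i. (LINT z|lebesgue. (z $ i) *\<^sub>R wigner hbar \<psi> z) = 0)"

text \<open>The Wigner transform is real-valued (substitute \<open>- y\<close> for \<open>y\<close> in its integral), so
  \<^const>\<open>Re\<close> below only converts the type of the entries.\<close>

definition covariance_matrix ::
    "real \<Rightarrow> (real^'n::finite \<Rightarrow> complex) \<Rightarrow> real^('n + 'n)^('n + 'n)" where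
  "covariance_matrix hbar \<psi> =
     (\<chi> i j. Re (LINT z|lebesgue. (z $ i * z $ j) *\<^sub>R wigner hbar \<psi> z))"

definition is_covariance_ellipsoid ::
    "real \<Rightarrow> (real^'n::finite \<Rightarrow> complex) \<Rightarrow> (real^('n + 'n)) set \<Rightarrow> bool" where
  "is_covariance_ellipsoid hbar \<psi> \<Omega> \<longleftrightarrow>
     centered_state hbar \<psi> \<and>
     invertible (covariance_matrix hbar \<psi>) \<and>
     \<Omega> = {z. (1/2) * ((matrix_inv (covariance_matrix hbar \<psi>) *v z) \<bullet> z) \<le> 1}"

definition gaussian_state :: "real^'n::finite^'n \<Rightarrow> real^'n \<Rightarrow> complex" where
  "gaussian_state \<Sigma>xx x = complex_of_real
     ((1 / (2 * pi)) powr (real CARD('n) / 4) * det \<Sigma>xx powr (-1/4) *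
      exp (- (1/4) * ((matrix_inv \<Sigma>xx *v x) \<bullet> x)))"

end

theory Submission
  imports Defs "HOL-Probability.Characteristic_Functions"
begin

text \<open>Write \<open>inverse A = B B\<^sup>T\<close> and \<open>C = A B\<close>, so that \<open>B\<^sup>T C = 1\<close>, \<open>X = B(ball(sqrt h))\<close> and
  \<open>Xh = C(ball(sqrt h))\<close>.  The matrix \<open>S = diag(B, C)\<close> is symplectic and \<open>\<Omega> = S(ball(sqrt h))\<close> is the
  required blob.  In the coordinates given by \<open>sqrt h S\<close> the product \<open>X \<times> Xh\<close> lies between the unit ball
  and the unit cube, and an ellipsoid \<open>d + N(ball(1))\<close> in the unit cube satisfies
  \<open>\<bar>d\<^sub>i\<bar> + norm(row\<^sub>i N) \<le> 1\<close>; by Hadamard's inequality \<open>\<bar>det N\<bar> \<le> 1\<close>, with equality only for the unit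
  ball.  Hence \<open>\<Omega>\<close> is the strictly largest inscribed ellipsoid, and since all quantum blobs have the
  same volume it is also the only inscribed blob.  For part (ii), the substitutions \<open>x = L a\<close>,
  \<open>y = 2 L v\<close> with \<open>L = sqrt(h/2) B\<close> turn the Wigner transform into the Fourier transform of a standard
  Gaussian; it is the density of the image of a standard Gaussian under \<open>T = sqrt(h/2) S\<close>, whose
  covariance matrix is \<open>T T\<^sup>T\<close>.\<close>

subsection \<open>Lebesgue measure and linear maps\<close>

lemma
  fixes A :: "real^'n::finite^'n"
  assumes "invertible A"
  shows matrix_mult_inv_right: "A ** matrix_inv A = mat 1"
    and matrix_mult_inv_left: "matrix_inv A ** A = mat 1"
proof -
  have "A ** matrix_inv A = mat 1 \<and> matrix_inv A ** A = mat 1"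
    using assms unfolding matrix_inv_def invertible_def by (rule someI_ex)
  then show "A ** matrix_inv A = mat 1" "matrix_inv A ** A = mat 1"
    by auto
qed

lemma matrix_inv_eqI:
  fixes A :: "real^'n::finite^'n"
  assumes "A ** B = mat 1"
  shows "invertible A" "matrix_inv A = B"
proof -
  show A: "invertible A"
    using assms invertible_right_inverse by blast
  show "matrix_inv A = B"
    by (metis A assms matrix_mul_assoc matrix_mul_lid matrix_mul_rid matrix_mult_inv_left)
qed

section \<open>Lebesgue measure on \<open>real^'n\<close> as a product measure\<close>

lemma measurable_vec_lambda_PiM:
  "vec_lambda \<in> Pi\<^sub>M (UNIV :: 'n::finite set) (\<lambda>_. lborel) \<rightarrow>\<^sub>M (borel :: (real^'n) measure)"
  by (subst borel_measurable_euclidean_space) (auto simp: Basis_vec_def inner_axis)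

lemma sum_Basis_vec: "(\<Sum>b\<in>Basis. f b) = (\<Sum>i\<in>UNIV. f (axis i 1))"
  for f :: "real^'n::finite \<Rightarrow> 'b::comm_monoid_add"
  by (simp add: Basis_vec_def UNION_singleton_eq_range sum.reindex inj_on_def axis_eq_axis)

lemma prod_Basis_vec: "(\<Prod>b\<in>Basis. f b) = (\<Prod>i\<in>UNIV. f (axis i 1))"
  for f :: "real^'n::finite \<Rightarrow> 'b::comm_monoid_mult"
  by (simp add: Basis_vec_def UNION_singleton_eq_range prod.reindex inj_on_def axis_eq_axis)

text \<open>Both measures give a box the product of its side lengths, and a Borel measure with these
  values is Lebesgue measure. The identification makes Fubini's theorem for
  \<open>Pi\<^sub>M\<close> available on \<open>real^'n\<close>.\<close>

lemma lborel_vec_eq_distr_PiM: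
  "(lborel :: (real^'n::finite) measure) =
     distr (Pi\<^sub>M (UNIV :: 'n set) (\<lambda>_. lborel)) borel vec_lambda"
proof (rule lborel_eqI)
  interpret product_sigma_finite "\<lambda>_::'n. lborel :: real measure" ..
  fix l u :: "real^'n" assume le: "\<And>b. b \<in> Basis \<Longrightarrow> l \<bullet> b \<le> u \<bullet> b"
  have le': "l $ i \<le> u $ i" for i
    using le[of "axis i 1"] by (simp add: inner_axis)
  have eq: "vec_lambda -` box l u \<inter> space (Pi\<^sub>M (UNIV :: 'n set) (\<lambda>_. lborel :: real measure))
      = Pi\<^sub>E UNIV (\<lambda>i. {l $ i <..< u $ i})"
    by (auto simp: mem_box_cart space_PiM PiE_def Pi_iff)
  have "emeasure (distr (Pi\<^sub>M (UNIV :: 'n set) (\<lambda>_. lborel)) borel vec_lambda) (box l u)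
      = (\<Prod>i\<in>UNIV. ennreal (u $ i - l $ i))"
    by (subst emeasure_distr, rule measurable_vec_lambda_PiM)
       (use le' in \<open>simp_all add: eq emeasure_PiM\<close>)
  also have "\<dots> = (\<Prod>b\<in>Basis. (u - l) \<bullet> b)"
    using le' by (simp add: prod_Basis_vec prod_ennreal inner_axis)
  finally show "emeasure (distr (Pi\<^sub>M (UNIV :: 'n set) (\<lambda>_. lborel)) borel vec_lambda) (box l u)
      = ennreal (\<Prod>b\<in>Basis. (u - l) \<bullet> b)" .
qed simp

text \<open>Fubini for integrands that factor over the coordinates, transported from the product
  measure. It reduces the Gaussian moments and the Gaussian Fourier transform to dimension
  one.\<close>

lemma
  fixes f :: "'n::finite \<Rightarrow> real \<Rightarrow> 'b::{real_normed_field,banach,second_countable_topology}"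
  assumes f: "\<And>i. integrable lborel (f i)"
  shows integrable_lborel_vec_prod: "integrable lborel (\<lambda>x::real^'n. \<Prod>i\<in>UNIV. f i (x $ i))"
    and integral_lborel_vec_prod:
      "(\<integral>x. (\<Prod>i\<in>UNIV. f i ((x::real^'n) $ i)) \<partial>lborel) = (\<Prod>i\<in>UNIV. integral\<^sup>L lborel (f i))"
proof -
  interpret product_sigma_finite "\<lambda>_::'n. lborel :: real measure" ..
  have [measurable]: "f i \<in> borel_measurable borel" for i
    using borel_measurable_integrable[OF f] by simp
  have m: "(\<lambda>x::real^'n. \<Prod>i\<in>UNIV. f i (x $ i)) \<in> borel_measurable borel"
    by measurable
  show "integrable lborel (\<lambda>x::real^'n. \<Prod>i\<in>UNIV. f i (x $ i))"
    unfolding lborel_vec_eq_distr_PiM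
    by (subst integrable_distr_eq[OF measurable_vec_lambda_PiM m])
       (use product_integrable_prod[of UNIV f] f in simp)
  show "(\<integral>x. (\<Prod>i\<in>UNIV. f i ((x::real^'n) $ i)) \<partial>lborel) = (\<Prod>i\<in>UNIV. integral\<^sup>L lborel (f i))"
    unfolding lborel_vec_eq_distr_PiM
    by (subst integral_distr[OF measurable_vec_lambda_PiM m])
       (use product_integral_prod[of UNIV f] f in simp)
qed

lemma borel_measurable_matrix_vector_mult [measurable]:
  "(\<lambda>x. A *v x) \<in> borel_measurable (borel :: (real^'n::finite) measure)"
  for A :: "real^'n^'m::finite"
  by (intro borel_measurable_continuous_onI matrix_vector_mult_linear_continuous_on)

section \<open>Linear change of variables, built up from elementary matrices\<close>

text \<open>With coordinate \<open>m\<close> integrated innermost, the shear is for fixed other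
  coordinates a translation by \<open>x n\<close>, under which one-dimensional Lebesgue measure is
  invariant.\<close>

lemma nn_integral_lborel_shear:
  fixes m n :: "'n::finite" and f :: "real^'n \<Rightarrow> ennreal"
  assumes [measurable]: "f \<in> borel_measurable borel" and "m \<noteq> n"
  shows "(\<integral>\<^sup>+x. f (\<chi> i. if i = m then x $ m + x $ n else x $ i) \<partial>lborel) = (\<integral>\<^sup>+x. f x \<partial>lborel)"
proof -
  interpret product_sigma_finite "\<lambda>_::'n. lborel :: real measure" ..
  let ?P = "\<lambda>I. Pi\<^sub>M (I :: 'n set) (\<lambda>_. lborel :: real measure)"
  let ?h = "\<lambda>x :: real^'n. \<chi> i. if i = m then x $ m + x $ n else x $ i"
  have "continuous_on UNIV (\<lambda>x :: real^'n. if i = m then x $ m + x $ n else x $ i)" for i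
    by (cases "i = m") (auto intro!: continuous_intros)
  then have [measurable]: "?h \<in> borel_measurable borel"
    by (intro borel_measurable_continuous_onI continuous_on_vec_lambda)
  have P: "?P UNIV = ?P (insert m (- {m}))"
    by (rule arg_cong[where f = ?P]) auto
  note [measurable] = measurable_vec_lambda_PiM
  have mP: "(\<lambda>x. g (vec_lambda x)) \<in> borel_measurable (?P (insert m (- {m})))"
    if "g \<in> borel_measurable borel" for g :: "real^'n \<Rightarrow> ennreal"
    using measurable_compose[OF measurable_vec_lambda_PiM that] P by simp
  have "(\<integral>\<^sup>+x. f (?h x) \<partial>lborel) = (\<integral>\<^sup>+x. f (?h (vec_lambda x)) \<partial>?P UNIV)"
    unfolding lborel_vec_eq_distr_PiM by (subst nn_integral_distr) auto
  also have "\<dots> = (\<integral>\<^sup>+x. (\<integral>\<^sup>+y. f (?h (vec_lambda (x(m := y)))) \<partial>lborel) \<partial>?P (- {m}))"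
    unfolding P using mP[of "\<lambda>x. f (?h x)"] by (subst product_nn_integral_insert) auto
  \<comment> \<open>The factor 1 gives the argument the affine shape \<open>t + c * y\<close> of
    \<open>nn_integral_real_affine\<close>.\<close>
  also have "\<dots> = (\<integral>\<^sup>+x. (\<integral>\<^sup>+y. f (vec_lambda (x(m := x n + 1 * y))) \<partial>lborel) \<partial>?P (- {m}))"
    using \<open>m \<noteq> n\<close> by (intro nn_integral_cong arg_cong[where f=f]) (auto simp: vec_eq_iff)
  also have "\<dots> = (\<integral>\<^sup>+x. (\<integral>\<^sup>+y. f (vec_lambda (x(m := y))) \<partial>lborel) \<partial>?P (- {m}))"
  proof (rule nn_integral_cong)
    fix x :: "'n \<Rightarrow> real"
    have "continuous_on UNIV (\<lambda>y. (x(m := y)) i)" for i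
      by (cases "i = m") (auto intro!: continuous_intros)
    then have "(\<lambda>y. vec_lambda (x(m := y))) \<in> borel_measurable borel"
      by (intro borel_measurable_continuous_onI continuous_on_vec_lambda)
    then have "(\<lambda>y. f (vec_lambda (x(m := y)))) \<in> borel_measurable borel"
      by (rule measurable_compose) simp
    from nn_integral_real_affine[OF this, of 1 "x n"]
    show "(\<integral>\<^sup>+y. f (vec_lambda (x(m := x n + 1 * y))) \<partial>lborel) = (\<integral>\<^sup>+y. f (vec_lambda (x(m := y))) \<partial>lborel)"
      by simp
  qed
  also have "\<dots> = (\<integral>\<^sup>+x. f (vec_lambda x) \<partial>?P UNIV)"
    unfolding P using mP[of f] by (subst product_nn_integral_insert) auto
  also have "\<dots> = (\<integral>\<^sup>+x. f x \<partial>lborel)"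
    unfolding lborel_vec_eq_distr_PiM by (subst nn_integral_distr) auto
  finally show ?thesis .
qed

text \<open>Exchanging two coordinates carries boxes to boxes whose side lengths are the same up to
  order, so Lebesgue measure is preserved.\<close>

lemma nn_integral_lborel_transpose:
  fixes m n :: "'n::finite" and f :: "real^'n \<Rightarrow> ennreal"
  assumes [measurable]: "f \<in> borel_measurable borel"
  shows "(\<integral>\<^sup>+x. f (\<chi> i. x $ Transposition.transpose m n i) \<partial>lborel) = (\<integral>\<^sup>+x. f x \<partial>lborel)"
proof -
  let ?t = "Transposition.transpose m n"
  let ?h = "\<lambda>x :: real^'n. \<chi> i. x $ ?t i"
  have [measurable]: "?h \<in> borel_measurable borel"
    by (intro borel_measurable_continuous_onI continuous_intros)
  have "lborel = distr lborel borel ?h"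
  proof (rule lborel_eqI)
    fix l u :: "real^'n" assume le: "\<And>b. b \<in> Basis \<Longrightarrow> l \<bullet> b \<le> u \<bullet> b"
    have le': "l $ i \<le> u $ i" for i
      using le[of "axis i 1"] by (simp add: inner_axis)
    have B: "(\<Prod>b\<in>Basis. v \<bullet> b) = (\<Prod>i\<in>UNIV. v $ i)" for v :: "real^'n"
      by (simp add: prod_Basis_vec inner_axis)
    have eq: "?h -` box l u = box (?h l) (?h u)"
      by (auto simp: mem_box_cart) (metis transpose_involutory)+
    have "(\<Prod>i\<in>UNIV. (u - l) $ ?t i) = (\<Prod>i\<in>UNIV. (u - l) $ i)"
      by (rule prod.reindex_bij_betw) (simp add: bij_betw_def)
    then have "(\<Prod>b\<in>Basis. (?h u - ?h l) \<bullet> b) = (\<Prod>b\<in>Basis. (u - l) \<bullet> b)"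
      by (simp add: B)
    moreover have "emeasure lborel (box (?h l) (?h u)) = (\<Prod>b\<in>Basis. (?h u - ?h l) \<bullet> b)"
      using le' by (intro emeasure_lborel_box) (auto simp: Basis_vec_def inner_axis)
    ultimately show "emeasure (distr lborel borel ?h) (box l u) = ennreal (\<Prod>b\<in>Basis. (u - l) \<bullet> b)"
      by (simp add: emeasure_distr eq)
  qed simp
  then have "(\<integral>\<^sup>+x. f x \<partial>lborel) = (\<integral>\<^sup>+x. f x \<partial>distr lborel borel ?h)"
    by simp
  also have "\<dots> = (\<integral>\<^sup>+x. f (?h x) \<partial>lborel)"
    by (subst nn_integral_distr) auto
  finally show ?thesis by simp
qed

lemma nn_integral_lborel_stretch:
  fixes c :: "'n::finite \<Rightarrow> real" and f :: "real^'n \<Rightarrow> ennreal"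
  assumes [measurable]: "f \<in> borel_measurable borel" and c: "\<And>i. c i \<noteq> 0"
  shows "\<bar>\<Prod>i\<in>UNIV. c i\<bar> * (\<integral>\<^sup>+x. f (\<chi> i. c i * x $ i) \<partial>lborel) = (\<integral>\<^sup>+x. f x \<partial>lborel)"
proof -
  let ?h = "\<lambda>x :: real^'n. \<chi> i. c i * x $ i"
  have [measurable]: "?h \<in> borel_measurable borel"
    by (intro borel_measurable_continuous_onI continuous_intros)
  \<comment> \<open>\<open>lborel_affine_euclidean\<close> expects scale factors indexed by basis
    vectors; this \<open>d\<close> takes the value \<open>c i\<close> at
    \<open>axis i 1\<close>.\<close>
  define d where "d = (\<lambda>b. \<Sum>i\<in>UNIV. c i * (b::real^'n) $ i)"
  have d: "d (axis i 1) = c i" for i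
    by (simp add: d_def axis_def if_distrib cong: if_cong)
  have "(\<lambda>x. 0 + (\<Sum>j\<in>Basis. (d j * (x \<bullet> j)) *\<^sub>R j)) = ?h"
    by (simp add: sum_Basis_vec inner_axis d fun_eq_iff vec_eq_iff) (simp add: axis_def if_distrib cong: if_cong)
  moreover have "(\<Prod>j\<in>Basis. \<bar>d j\<bar>) = \<bar>\<Prod>i\<in>UNIV. c i\<bar>"
    by (simp add: prod_Basis_vec d abs_prod)
  moreover have "d j \<noteq> 0" if "j \<in> Basis" for j
    using that c by (auto simp: Basis_vec_def d)
  ultimately have "lborel = density (distr lborel borel ?h) (\<lambda>_. ennreal \<bar>\<Prod>i\<in>UNIV. c i\<bar>)"
    using lborel_affine_euclidean[of d 0] by simp
  then have "(\<integral>\<^sup>+x. f x \<partial>lborel) = (\<integral>\<^sup>+x. f x \<partial>density (distr lborel borel ?h) (\<lambda>_. ennreal \<bar>\<Prod>i\<in>UNIV. c i\<bar>))"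
    by simp
  also have "\<dots> = \<bar>\<Prod>i\<in>UNIV. c i\<bar> * (\<integral>\<^sup>+x. f (?h x) \<partial>lborel)"
    by (simp add: nn_integral_density nn_integral_distr nn_integral_cmult)
  finally show ?thesis by simp
qed

lemma det_shear:
  assumes "m \<noteq> n"
  shows "det ((\<chi> i j. of_bool (i = m \<and> j = n \<or> i = j)) :: real^'n::finite^'n) = 1"
proof -
  have "((\<chi> i j. of_bool (i = m \<and> j = n \<or> i = j)) :: real^'n^'n)
    = (\<chi> k. if k = m then row m (mat 1) + 1 *s row n (mat 1) else row k (mat 1))"
    using assms by (auto simp: vec_eq_iff row_def mat_def)
  then show ?thesis
    using det_row_operation[OF assms, where c = 1 and A = "mat 1 :: real^'n^'n"] by simp
qed

text \<open>The linear change of variables in \<^theory>\<open>HOL-Analysis.Change_Of_Vars\<close> requires a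
  well-ordered index type, which \<^typ>\<open>'n + 'n\<close> is not.\<close>

lemma nn_integral_lborel_linear:
  fixes A :: "real^'n::finite^'n" and f :: "real^'n \<Rightarrow> ennreal"
  assumes "det A \<noteq> 0" and "f \<in> borel_measurable borel"
  shows "\<bar>det A\<bar> * (\<integral>\<^sup>+x. f (A *v x) \<partial>lborel) = (\<integral>\<^sup>+x. f x \<partial>lborel)"
proof -
  \<comment> \<open>Quantifying over \<open>f\<close> inside \<open>P\<close> lets the product case
    apply the statement for \<open>B\<close> to \<open>f\<close> composed with \<open>A\<close>. The
    premise on the determinant makes the zero-row case of the induction vacuous.\<close>
  define P where "P = (\<lambda>A :: real^'n^'n. det A \<noteq> 0 \<longrightarrow> (\<forall>f\<in>borel_measurable borel.
    \<bar>det A\<bar> * (\<integral>\<^sup>+x. f (A *v x) \<partial>lborel) = (\<integral>\<^sup>+x. f x \<partial>lborel)))"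
  have "P A"
  proof (rule induct_matrix_elementary_alt)
    fix A B assume P: "P A" "P B"
    show "P (A ** B)" unfolding P_def
    proof (intro impI ballI)
      fix f :: "real^'n \<Rightarrow> ennreal" assume [measurable]: "f \<in> borel_measurable borel" and "det (A ** B) \<noteq> 0"
      then have d: "det A \<noteq> 0" "det B \<noteq> 0" by (auto simp: det_mul)
      have "(\<integral>\<^sup>+x. f x \<partial>lborel) = \<bar>det A\<bar> * (\<integral>\<^sup>+x. f (A *v x) \<partial>lborel)"
        using P d by (simp add: P_def)
      also have "(\<integral>\<^sup>+x. f (A *v x) \<partial>lborel) = \<bar>det B\<bar> * (\<integral>\<^sup>+x. f (A *v (B *v x)) \<partial>lborel)"
        using P(2) d unfolding P_def by (auto dest!: bspec[where x = "\<lambda>x. f (A *v x)"])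
      finally show "\<bar>det (A ** B)\<bar> * (\<integral>\<^sup>+x. f (A ** B *v x) \<partial>lborel) = (\<integral>\<^sup>+x. f x \<partial>lborel)"
        by (simp add: det_mul abs_mult ennreal_mult matrix_vector_mul_assoc mult.assoc)
    qed
  next
    fix A :: "real^'n^'n" and i assume "row i A = 0"
    then show "P A" by (simp add: P_def det_zero_row)
  next
    fix A :: "real^'n^'n" assume A: "\<And>i j. i \<noteq> j \<Longrightarrow> A $ i $ j = 0"
    have "A *v x = (\<chi> i. A $ i $ i * x $ i)" for x
    proof -
      have "(\<Sum>j\<in>UNIV. A $ i $ j * x $ j) = A $ i $ i * x $ i" for i
        by (subst sum.remove[of _ i]) (auto simp: A intro!: sum.neutral)
      then show ?thesis by (simp add: matrix_vector_mult_def)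
    qed
    then show "P A"
      using nn_integral_lborel_stretch[of _ "\<lambda>i. A $ i $ i"] by (simp add: P_def det_diagonal A)
  next
    fix m n :: 'n assume "m \<noteq> n"
    have "(\<chi> i j. mat 1 $ i $ Transposition.transpose m n j) *v x = (\<chi> i. x $ Transposition.transpose m n i)" for x :: "real^'n"
    proof -
      have "(\<Sum>j\<in>UNIV. (if i = Transposition.transpose m n j then 1 else 0) * x $ j) = x $ Transposition.transpose m n i" for i
      proof -
        have "i = Transposition.transpose m n j \<longleftrightarrow> j = Transposition.transpose m n i" for j
          by (metis transpose_involutory)
        then show ?thesis by (simp add: if_distrib[where f = "\<lambda>c. c * _"] cong: if_cong)
      qed
      then show ?thesis by (simp add: matrix_vector_mult_def mat_def)
    qed
    moreover have "\<bar>det ((\<chi> i j. mat 1 $ i $ Transposition.transpose m n j) :: real^'n^'n)\<bar> = 1"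
      by (simp add: det_permute_columns permutes_swap_id sign_swap_id abs_mult)
    ultimately show "P (\<chi> i j. mat 1 $ i $ Transposition.transpose m n j)"
      by (simp add: P_def nn_integral_lborel_transpose)
  next
    fix m n :: 'n assume mn: "m \<noteq> n"
    have "(\<chi> i j. of_bool (i = m \<and> j = n \<or> i = j)) *v x = (\<chi> i. if i = m then x $ m + x $ n else x $ i)" for x :: "real^'n"
    proof -
      have "(\<Sum>j\<in>UNIV. of_bool (i = m \<and> j = n \<or> i = j) * x $ j)
         = (\<Sum>j\<in>UNIV. (if j = i then x $ j else 0) + (if j = n then (if i = m then x $ j else 0) else 0))" for i
        using mn by (intro sum.cong) auto
      then have "(\<Sum>j\<in>UNIV. of_bool (i = m \<and> j = n \<or> i = j) * x $ j)
         = (if i = m then x $ m + x $ n else x $ i)" for i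
        by (simp add: sum.distrib)
      then show ?thesis by (simp add: matrix_vector_mult_def)
    qed
    with mn show "P (\<chi> i j. of_bool (i = m \<and> j = n \<or> i = j))"
      by (simp add: P_def nn_integral_lborel_shear det_shear del: of_bool_or_iff)
  qed
  with assms show ?thesis by (simp add: P_def)
qed

text \<open>The change of variables as an identity of measures, so that integrability and Bochner
  integrals follow from the rules for \<open>density\<close> and \<open>distr\<close>.\<close>

lemma lborel_eq_density_distr_linear:
  fixes A :: "real^'n::finite^'n"
  assumes "det A \<noteq> 0"
  shows "lborel = density (distr lborel borel ((*v) A)) (\<lambda>_. ennreal \<bar>det A\<bar>)"
proof (rule measure_eqI)
  fix S :: "(real^'n) set" assume "S \<in> sets lborel"
  then have [measurable]: "S \<in> sets borel" by simp
  have "emeasure lborel S = \<bar>det A\<bar> * (\<integral>\<^sup>+x. indicator S (A *v x) \<partial>lborel)"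
    using nn_integral_lborel_linear[OF assms, of "indicator S"] by simp
  also have "(\<integral>\<^sup>+x. indicator S (A *v x) \<partial>lborel) = (\<integral>\<^sup>+x. indicator S x \<partial>distr lborel borel ((*v) A))"
    by (simp add: nn_integral_distr del: nn_integral_indicator)
  also have "\<bar>det A\<bar> * \<dots> = emeasure (density (distr lborel borel ((*v) A)) (\<lambda>_. ennreal \<bar>det A\<bar>)) S"
    by (simp add: emeasure_density nn_integral_cmult)
  finally show "emeasure lborel S = emeasure (density (distr lborel borel ((*v) A)) (\<lambda>_. ennreal \<bar>det A\<bar>)) S" .
qed simp

lemma
  fixes A :: "real^'n::finite^'n" and f :: "real^'n \<Rightarrow> 'b::{banach,second_countable_topology}"
  assumes A: "det A \<noteq> 0" and f [measurable]: "f \<in> borel_measurable borel"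
  shows integrable_lborel_linear_iff: "integrable lborel (\<lambda>x. f (A *v x)) \<longleftrightarrow> integrable lborel f"
    and integral_lborel_linear: "integral\<^sup>L lborel f = \<bar>det A\<bar> *\<^sub>R (\<integral>x. f (A *v x) \<partial>lborel)"
proof -
  have "integrable lborel f \<longleftrightarrow> integrable (density (distr lborel borel ((*v) A)) (\<lambda>_. ennreal \<bar>det A\<bar>)) f"
    using lborel_eq_density_distr_linear[OF A] by simp
  also have "\<dots> \<longleftrightarrow> integrable lborel (\<lambda>x. \<bar>det A\<bar> *\<^sub>R f (A *v x))"
    by (subst integrable_density) (auto simp: integrable_distr_eq)
  also have "\<dots> \<longleftrightarrow> integrable lborel (\<lambda>x. f (A *v x))"
    using integrable_scaleR_right[of "inverse \<bar>det A\<bar>" lborel "\<lambda>x. \<bar>det A\<bar> *\<^sub>R f (A *v x)"] A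
    by (auto intro!: integrable_scaleR_right)
  finally show "integrable lborel (\<lambda>x. f (A *v x)) \<longleftrightarrow> integrable lborel f" ..
  have "integral\<^sup>L lborel f = integral\<^sup>L (density (distr lborel borel ((*v) A)) (\<lambda>_. ennreal \<bar>det A\<bar>)) f"
    using lborel_eq_density_distr_linear[OF A] by simp
  also have "\<dots> = \<bar>det A\<bar> *\<^sub>R (\<integral>x. f (A *v x) \<partial>lborel)"
    by (subst integral_density) (auto simp: integral_distr)
  finally show "integral\<^sup>L lborel f = \<bar>det A\<bar> *\<^sub>R (\<integral>x. f (A *v x) \<partial>lborel)" .
qed

lemma measure_lebesgue_affine_image:
  fixes A :: "real^'n::finite^'n"
  assumes A: "invertible A" and S: "S \<in> sets borel"
  shows "measure lebesgue ((\<lambda>x. c + A *v x) ` S) = \<bar>det A\<bar> * measure lebesgue S"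
proof -
  have d: "det A \<noteq> 0" using A by (simp add: invertible_det_nz)
  define B where "B = matrix_inv A"
  have AB: "A ** B = mat 1" "B ** A = mat 1"
    using A by (auto simp: B_def matrix_mult_inv_left matrix_mult_inv_right)
  \<comment> \<open>Seen as a preimage under the inverse, the image is a Borel set.\<close>
  have im: "(\<lambda>x. A *v x) ` S = (\<lambda>x. B *v x) -` S"
    by (auto simp: AB matrix_vector_mul_assoc image_iff) (metis AB matrix_vector_mul_assoc matrix_vector_mul_lid)
  have "(\<lambda>x. B *v x) -` S \<inter> space borel \<in> sets borel"
    by (rule measurable_sets[OF borel_measurable_matrix_vector_mult S])
  then have imb: "(\<lambda>x. A *v x) ` S \<in> sets borel" by (simp add: im)
  have "measure lebesgue ((\<lambda>x. c + A *v x) ` S) = measure lebesgue ((+) c ` (\<lambda>x. A *v x) ` S)"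
    by (simp add: image_image)
  also have "\<dots> = measure lebesgue ((\<lambda>x. A *v x) ` S)"
    by (rule measure_translation)
  also have "\<dots> = \<bar>det A\<bar> * measure lebesgue S"
  proof -
    have "emeasure lborel ((\<lambda>x. A *v x) ` S) = (\<integral>\<^sup>+x. indicator ((\<lambda>x. A *v x) ` S) x \<partial>lborel)"
      using imb by simp
    also have "\<dots> = \<bar>det A\<bar> * (\<integral>\<^sup>+x. indicator ((\<lambda>x. A *v x) ` S) (A *v x) \<partial>lborel)"
      using nn_integral_lborel_linear[OF d, of "indicator ((\<lambda>x. A *v x) ` S)"] imb by simp
    also have "(\<lambda>x. indicator ((\<lambda>x. A *v x) ` S) (A *v x) :: ennreal) = indicator S"
      by (auto simp: im indicator_def matrix_vector_mul_assoc AB)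
    finally show ?thesis using S imb
      by (simp add: measure_def enn2real_mult)
  qed
  finally show ?thesis .
qed

subsection \<open>Determinants and the inequality of Hadamard\<close>

lemma positive_definite_inner_commute:
  assumes "positive_definite A"
  shows "(A *v x) \<bullet> y = (A *v y) \<bullet> x"
  using assms by (metis dot_lmul_matrix inner_commute positive_definite_def vector_transpose_matrix)

text \<open>The quadratic form has a positive minimum on the compact unit sphere, and homogeneity
  extends the bound to all vectors.\<close>

lemma positive_definite_bound:
  fixes A :: "real^'n::finite^'n"
  assumes A: "positive_definite A"
  obtains c where "c > 0" "\<And>x. c * (norm x)\<^sup>2 \<le> (A *v x) \<bullet> x"
proof -
  let ?q = "\<lambda>x. (A *v x) \<bullet> x"
  let ?S = "sphere (0 :: real^'n) 1"
  have "continuous_on ?S ?q"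
    by (intro continuous_intros)
  moreover have "axis undefined 1 \<in> ?S" by simp
  ultimately obtain y where y: "y \<in> ?S" "\<And>x. x \<in> ?S \<Longrightarrow> ?q y \<le> ?q x"
    using continuous_attains_inf[of ?S ?q] compact_sphere by blast
  show thesis
  proof
    show "?q y > 0" using y(1) A by (cases "y = 0") (auto simp: positive_definite_def)
    fix x :: "real^'n"
    show "?q y * (norm x)\<^sup>2 \<le> ?q x"
    proof (cases "x = 0")
      case False
      define u where "u = x /\<^sub>R norm x"
      have "u \<in> ?S" and x: "x = norm x *\<^sub>R u" using False by (auto simp: u_def)
      then have "?q y \<le> ?q u" using y by simp
      moreover have "?q x = ?q u * (norm x)\<^sup>2"
        by (subst (1 2) x) (simp add: matrix_vector_mult_scaleR power2_eq_square)
      ultimately show ?thesis by (simp add: mult_right_mono)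
    qed simp
  qed
qed

section \<open>Matrices of maximal determinant\<close>

lemma continuous_on_det: "continuous_on S (det :: real^'n::finite^'n \<Rightarrow> real)"
  unfolding det_def by (intro continuous_intros)

lemma det_scale_row:
  fixes M :: "real^'n::finite^'n"
  shows "det (\<chi> k. if k = i then c *s (M $ i) else M $ k) = c * det M"
proof -
  have "(\<chi> k. if k = i then M $ i else M $ k) = M"
    by (simp add: vec_eq_iff)
  then show ?thesis
    using det_row_mul[of i c "\<lambda>_. M $ i" "\<lambda>k. M $ k"] by simp
qed

text \<open>At a maximum of the determinant the rows are orthogonal, since subtracting from a row its
  projection onto another one shortens it without changing the determinant, and there would be room
  for rescaling.  For general \<open>A\<close> this yields the factorisation of \<open>A\<close>, for \<open>A = mat 1\<close> it is
  Hadamard's inequality with its equality case.\<close>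

lemma det_max_rows_orthonormal:
  fixes A M :: "real^'n::finite^'n"
  assumes A: "positive_definite A"
    and M: "\<And>i. (A *v (M $ i)) \<bullet> (M $ i) \<le> 1"
    and max: "\<And>N :: real^'n^'n. (\<And>i. (A *v (N $ i)) \<bullet> (N $ i) \<le> 1) \<Longrightarrow> \<bar>det N\<bar> \<le> \<bar>det M\<bar>"
    and nz: "det M \<noteq> 0"
  shows "(A *v (M $ i)) \<bullet> (M $ j) = (if i = j then 1 else 0)"
proof -
  let ?q = "\<lambda>x y. (A *v x) \<bullet> y"
  have nzrow: "M $ i \<noteq> 0" for i
    using nz det_zero_row(1)[of i M] by (auto simp: row_def vec_eq_iff)
  have pos: "?q (M $ i) (M $ i) > 0" for i
    using A nzrow by (auto simp: positive_definite_def)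
  \<comment> \<open>A row of value below 1 could be stretched, which would increase the determinant.
    The claim covers every admissible \<open>N\<close> with the determinant of \<open>M\<close>,
    because it is applied to \<open>M\<close> and also to \<open>M\<close> after a row
    operation.\<close>
  have unit: "?q (N $ i) (N $ i) = 1" if N: "\<And>i. ?q (N $ i) (N $ i) \<le> 1" "det N = det M" for N i
  proof (rule ccontr)
    assume "?q (N $ i) (N $ i) \<noteq> 1"
    with N have lt: "?q (N $ i) (N $ i) < 1" by (simp add: order_less_le)
    have "N $ i \<noteq> 0"
      using nz N(2) det_zero_row(1)[of i N] by (auto simp: row_def vec_eq_iff)
    then have p: "?q (N $ i) (N $ i) > 0"
      using A by (auto simp: positive_definite_def)
    define c where "c = 1 / sqrt (?q (N $ i) (N $ i))"
    have "c > 1" using lt p by (simp add: c_def)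
    have c2: "c * (c * ?q (N $ i) (N $ i)) = 1"
      using p by (simp add: c_def)
    define N' where "N' = (\<chi> k. if k = i then c *s (N $ i) else N $ k)"
    have "?q (N' $ k) (N' $ k) \<le> 1" for k
      using N(1)[of k] c2 by (auto simp: N'_def matrix_vector_mult_scaleR scalar_mult_eq_scaleR)
    then have "\<bar>det N'\<bar> \<le> \<bar>det M\<bar>" by (rule max)
    then have "c * \<bar>det M\<bar> \<le> \<bar>det M\<bar>"
      using \<open>c > 1\<close> by (simp add: N'_def det_scale_row abs_mult N(2))
    then show False using \<open>c > 1\<close> nz by simp
  qed
  show ?thesis
  proof (cases "i = j")
    case True
    then show ?thesis using unit[of M] M by simp
  next
    case False
    define r where "r = ?q (M $ i) (M $ j)"
    define N where "N = (\<chi> k. if k = i then row i M + (- r) *s row j M else row k M)"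
    have dN: "det N = det M"
      unfolding N_def by (rule det_row_operation[OF False])
    have rows: "row k M = M $ k" for k by (simp add: row_def vec_eq_iff)
    have uj: "?q (M $ k) (M $ k) = 1" for k using unit[of M] M by simp
    have qi: "?q (N $ i) (N $ i) = 1 - r\<^sup>2"
    proof -
      have "?q (M $ j) (M $ i) = r"
        using positive_definite_inner_commute[OF A] by (simp add: r_def)
      moreover have "N $ i = M $ i - r *\<^sub>R M $ j"
        by (simp add: N_def rows scalar_mult_eq_scaleR)
      ultimately show ?thesis
        by (simp add: matrix_vector_mult_scaleR matrix_vector_mult_diff_distrib inner_diff_left
            inner_diff_right uj r_def[symmetric] power2_eq_square)
    qed
    have "?q (N $ k) (N $ k) \<le> 1" for k
      using qi M[of k] by (cases "k = i") (simp_all add: N_def rows)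
    \<comment> \<open>By \<open>unit\<close> the value of row \<open>i\<close> of \<open>N\<close>
      is 1, while \<open>qi\<close> computes it as \<open>1 - r\<^sup>2\<close>.\<close>
    from unit[OF this dN, of i] qi have "r = 0" by simp
    then show ?thesis using False by (simp add: r_def)
  qed
qed

text \<open>The admissible matrices form a closed set, bounded by
  \<open>positive_definite_bound\<close>, on which the continuous modulus of the determinant attains
  its maximum. This maximum is nonzero because a small multiple of the identity is
  admissible.\<close>

lemma ex_det_max:
  fixes A :: "real^'n::finite^'n"
  assumes A: "positive_definite A"
  shows "\<exists>M :: real^'n^'n. (\<forall>i. (A *v (M $ i)) \<bullet> (M $ i) \<le> 1) \<and>
    (\<forall>N :: real^'n^'n. (\<forall>i. (A *v (N $ i)) \<bullet> (N $ i) \<le> 1) \<longrightarrow> \<bar>det N\<bar> \<le> \<bar>det M\<bar>) \<and> det M \<noteq> 0"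
proof -
  let ?q = "\<lambda>x. (A *v x) \<bullet> x"
  define K where "K = {M :: real^'n^'n. \<forall>i. ?q (M $ i) \<le> 1}"
  obtain c where c: "c > 0" "\<And>x. c * (norm x)\<^sup>2 \<le> ?q x"
    using positive_definite_bound[OF A] by blast
  have "closed K"
    unfolding K_def
    by (intro closed_Collect_all closed_Collect_le continuous_intros
        continuous_on_compose2[OF matrix_vector_mult_linear_continuous_on[of UNIV A]]) auto
  moreover have "bounded K"
  proof (rule boundedI)
    fix M assume "M \<in> K"
    have "norm (M $ i) \<le> sqrt (1 / c)" for i
    proof (rule real_le_rsqrt)
      have "c * (norm (M $ i))\<^sup>2 \<le> 1"
        using c(2)[of "M $ i"] \<open>M \<in> K\<close> by (auto simp: K_def intro: order_trans)
      then show "(norm (M $ i))\<^sup>2 \<le> 1 / c" using c(1) by (simp add: field_simps)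
    qed
    then have "(\<Sum>i\<in>UNIV. norm (M $ i)) \<le> (\<Sum>i\<in>(UNIV::'n set). sqrt (1 / c))"
      by (intro sum_mono)
    moreover have "norm M \<le> (\<Sum>i\<in>UNIV. norm (M $ i))"
      unfolding norm_vec_def by (rule L2_set_le_sum) simp
    ultimately show "norm M \<le> (\<Sum>i\<in>(UNIV::'n set). sqrt (1 / c))"
      by (rule order_trans[rotated])
  qed
  ultimately have "compact K" by (simp add: compact_eq_bounded_closed)
  \<comment> \<open>\<open>e\<close> dominates the value of the form at every axis, so the scaled
    identity \<open>D\<close> below is admissible; the added 1 keeps the denominator positive given
    only \<open>e \<ge> 0\<close>.\<close>
  define e where "e = (\<Sum>i\<in>UNIV. ?q (axis i 1))"
  have q0: "?q x \<ge> 0" for x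
    using c(1) order_trans[OF _ c(2)[of x]] by simp
  define D :: "real^'n^'n" where "D = (\<chi> i j. if i = j then 1 / sqrt (1 + e) else 0)"
  have e0: "e \<ge> 0" unfolding e_def by (intro sum_nonneg q0)
  have "D $ i = (1 / sqrt (1 + e)) *\<^sub>R axis i 1" for i
    by (auto simp: D_def vec_eq_iff axis_def)
  then have "?q (D $ i) = ?q (axis i 1) / (1 + e)" for i
    using e0 by (simp add: matrix_vector_mult_scaleR)
  moreover have "?q (axis i 1) \<le> 1 + e" for i
    using member_le_sum[of i UNIV "\<lambda>i. ?q (axis i 1)"] q0 by (simp add: e_def add_increasing)
  ultimately have D: "D \<in> K"
    using e0 by (simp add: K_def divide_le_eq_1)
  have detD: "det D \<noteq> 0"
    using e0 by (subst det_diagonal) (auto simp: D_def)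
  have "continuous_on K (\<lambda>M. \<bar>det M\<bar>)"
    by (intro continuous_intros continuous_on_det)
  with \<open>compact K\<close> D obtain M where M: "M \<in> K" "\<And>N. N \<in> K \<Longrightarrow> \<bar>det N\<bar> \<le> \<bar>det M\<bar>"
    using continuous_attains_sup[of K "\<lambda>M. \<bar>det M\<bar>"] by blast
  have "det M \<noteq> 0" using M(2)[OF D] detD by auto
  with M show ?thesis by (auto simp: K_def)
qed

text \<open>Turns orthonormality of the rows of \<open>M\<close> for the form of \<open>A\<close>
  into a matrix equation.\<close>

lemma matrix_mult_rows_inner:
  fixes M A :: "real^'n::finite^'n"
  shows "(M ** A ** transpose M) $ i $ j = (A *v (M $ j)) \<bullet> (M $ i)"
proof -
  have "(M ** A ** transpose M) $ i $ j = (\<Sum>l\<in>UNIV. \<Sum>k\<in>UNIV. M $ i $ k * A $ k $ l * M $ j $ l)"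
    by (simp add: matrix_matrix_mult_def transpose_def sum_distrib_right)
  also have "\<dots> = (\<Sum>k\<in>UNIV. \<Sum>l\<in>UNIV. M $ i $ k * A $ k $ l * M $ j $ l)"
    by (rule sum.swap)
  also have "\<dots> = (A *v (M $ j)) \<bullet> (M $ i)"
    by (simp add: matrix_vector_mult_def inner_vec_def sum_distrib_left sum_distrib_right mult_ac)
  finally show ?thesis .
qed

text \<open>The transpose of a determinant maximiser is such a \<open>B\<close>, since its columns
  are orthonormal for the form of \<open>A\<close>. It plays the part of an inverse square root of
  \<open>A\<close>, but need not be symmetric.\<close>

lemma positive_definite_factor:
  fixes A :: "real^'n::finite^'n"
  assumes A: "positive_definite A"
  obtains B :: "real^'n^'n" where "transpose B ** A ** B = mat 1"
proof -
  obtain M :: "real^'n^'n" where M: "\<And>i. (A *v (M $ i)) \<bullet> (M $ i) \<le> 1"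
    "\<And>N :: real^'n^'n. (\<And>i. (A *v (N $ i)) \<bullet> (N $ i) \<le> 1) \<Longrightarrow> \<bar>det N\<bar> \<le> \<bar>det M\<bar>" "det M \<noteq> 0"
    using ex_det_max[OF A] by blast
  from det_max_rows_orthonormal[OF A M] have "M ** A ** transpose M = mat 1"
    by (auto simp: vec_eq_iff matrix_mult_rows_inner mat_def)
  then show thesis
    using that[of "transpose M"] by simp
qed

text \<open>For the form of \<open>mat 1\<close> a maximiser \<open>L\<close> has orthonormal rows,
  so its determinant has modulus 1. A matrix that also reaches modulus 1 is itself a maximiser and
  hence orthogonal.\<close>

lemma hadamard_det_le_1:
  fixes M :: "real^'n::finite^'n"
  assumes M: "\<And>i. norm (M $ i) \<le> 1"
  shows "\<bar>det M\<bar> \<le> 1" and "\<bar>det M\<bar> = 1 \<Longrightarrow> M ** transpose M = mat 1"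
proof -
  have A: "positive_definite (mat 1 :: real^'n^'n)"
    by (simp add: positive_definite_def)
  have n: "(mat 1 *v x) \<bullet> x \<le> 1 \<longleftrightarrow> norm x \<le> 1" for x :: "real^'n"
    by (simp add: norm_eq_sqrt_inner)
  obtain L :: "real^'n^'n" where L: "\<forall>i. (mat 1 *v (L $ i)) \<bullet> (L $ i) \<le> 1"
    "\<forall>N :: real^'n^'n. (\<forall>i. (mat 1 *v (N $ i)) \<bullet> (N $ i) \<le> 1) \<longrightarrow> \<bar>det N\<bar> \<le> \<bar>det L\<bar>" "det L \<noteq> 0"
    using ex_det_max[OF A] by blast
  have max: "\<bar>det N\<bar> \<le> \<bar>det L\<bar>" if "\<And>i. norm (N $ i) \<le> 1" for N :: "real^'n^'n"
    using L(2) n that by blast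
  have orth: "N ** transpose N = mat 1" if N: "\<And>i. norm (N $ i) \<le> 1" "\<bar>det N\<bar> = \<bar>det L\<bar>" for N :: "real^'n^'n"
  proof -
    have "(mat 1 *v (N $ i)) \<bullet> (N $ j) = (if i = j then 1 else 0)" for i j
    proof (rule det_max_rows_orthonormal[OF A])
      show "(mat 1 *v (N $ i)) \<bullet> (N $ i) \<le> 1" for i using N(1) n by blast
      show "\<bar>det N'\<bar> \<le> \<bar>det N\<bar>" if "\<And>i. (mat 1 *v (N' $ i)) \<bullet> (N' $ i) \<le> 1" for N' :: "real^'n^'n"
        using L(2) that N(2) by auto
      show "det N \<noteq> 0" using N(2) L(3) by auto
    qed
    then have "(N ** transpose N) $ i $ j = (if i = j then 1 else 0)" for i j
      using matrix_mult_rows_inner[of N "mat 1" i j] by auto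
    then show ?thesis by (simp add: vec_eq_iff mat_def)
  qed
  have "norm (L $ i) \<le> 1" for i using L(1) n by blast
  then have "L ** transpose L = mat 1" using orth by blast
  from arg_cong[OF this, of det] have "(det L)\<^sup>2 = 1"
    by (simp add: det_mul det_transpose power2_eq_square)
  then have detL: "\<bar>det L\<bar> = 1" by (auto simp: power2_eq_1_iff)
  show "\<bar>det M\<bar> \<le> 1" using max[OF M] detL by simp
  show "M ** transpose M = mat 1" if "\<bar>det M\<bar> = 1"
    using orth[OF M] that detL by simp
qed

subsection \<open>Phase space and inscribed ellipsoids\<close>

lemma transpose_mult_inner: "(transpose A *v x) \<bullet> y = x \<bullet> (A *v y)"
  for A :: "real^'n::finite^'m::finite"
  by (metis dot_lmul_matrix inner_commute transpose_matrix_vector)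

lemma matrix_eqI_inner:
  fixes A B :: "real^'n::finite^'m::finite"
  assumes "\<And>x y. (A *v x) \<bullet> y = (B *v x) \<bullet> y"
  shows "A = B"
  using assms by (metis matrix_eq vector_eq_rdot)

lemma sum_UNIV_Plus: "(\<Sum>i\<in>UNIV. f i) = (\<Sum>i\<in>UNIV. f (Inl i)) + (\<Sum>i\<in>UNIV. f (Inr i))"
  for f :: "'a::finite + 'b::finite \<Rightarrow> 'c::comm_monoid_add"
  by (subst UNIV_sum, subst sum.union_disjoint) (auto simp: sum.reindex)

lemma phase_eqI:
  assumes "pos_proj z = pos_proj w" and "mom_proj z = mom_proj w"
  shows "z = w"
proof -
  have "z $ i = w $ i" for i
    using assms by (cases i) (auto simp: pos_proj_def mom_proj_def vec_eq_iff)
  then show ?thesis by (simp add: vec_eq_iff)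
qed

lemma proj_scaleR [simp]: "pos_proj (c *\<^sub>R w) = c *\<^sub>R pos_proj w" "mom_proj (c *\<^sub>R w) = c *\<^sub>R mom_proj w"
  by (simp_all add: pos_proj_def mom_proj_def vec_eq_iff)

lemma inner_phase: "z \<bullet> w = pos_proj z \<bullet> pos_proj w + mom_proj z \<bullet> mom_proj w"
  by (simp add: inner_vec_def sum_UNIV_Plus pos_proj_def mom_proj_def)

lemma norm_phase: "(norm z)\<^sup>2 = (norm (pos_proj z))\<^sup>2 + (norm (mom_proj z))\<^sup>2"
  by (simp add: power2_norm_eq_inner inner_phase)

definition phase_pair :: "real^'n \<Rightarrow> real^'n \<Rightarrow> real^('n::finite + 'n)" where
  "phase_pair x p = (\<chi> i. case i of Inl a \<Rightarrow> x $ a | Inr a \<Rightarrow> p $ a)"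

lemma proj_phase_pair [simp]: "pos_proj (phase_pair x p) = x" "mom_proj (phase_pair x p) = p"
  by (simp_all add: phase_pair_def pos_proj_def mom_proj_def vec_eq_iff)

definition block_diag :: "real^'n^'n \<Rightarrow> real^'n^'n \<Rightarrow> real^('n::finite + 'n)^('n + 'n)" where
  "block_diag B C = (\<chi> i j. case (i, j) of
     (Inl a, Inl b) \<Rightarrow> B $ a $ b | (Inr a, Inr b) \<Rightarrow> C $ a $ b | _ \<Rightarrow> 0)"

lemma proj_block_diag [simp]:
  "pos_proj (block_diag B C *v z) = B *v pos_proj z"
  "mom_proj (block_diag B C *v z) = C *v mom_proj z"
  by (simp_all add: block_diag_def pos_proj_def mom_proj_def matrix_vector_mult_def vec_eq_iff sum_UNIV_Plus)

lemma proj_symp_J [simp]: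
  "pos_proj (symp_J *v z) = mom_proj z"
  "mom_proj (symp_J *v z) = - pos_proj z"
proof -
  have "(\<Sum>b\<in>UNIV. (if a = b then c else 0) * f b) = c * f a" for a :: 'a and c :: real and f
    by (subst sum.remove[of _ a]) (auto intro!: sum.neutral)
  then show "pos_proj (symp_J *v z) = mom_proj z" "mom_proj (symp_J *v z) = - pos_proj z"
    by (simp_all add: symp_J_def pos_proj_def mom_proj_def matrix_vector_mult_def vec_eq_iff sum_UNIV_Plus)
qed

text \<open>\<open>symp_J\<close> is an orthogonal matrix. Nonvanishing allows its determinant to be
  cancelled in the defining equation of \<open>Sp\<close>.\<close>

lemma det_symp_J: "det (symp_J :: real^('n::finite + 'n)^('n + 'n)) \<noteq> 0"
proof -
  have "transpose symp_J ** symp_J = (mat 1 :: real^('n + 'n)^('n + 'n))"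
    by (rule matrix_eqI_inner)
       (simp only: matrix_vector_mul_assoc[symmetric] transpose_mult_inner, simp add: inner_phase)
  from arg_cong[OF this, of det] show ?thesis
    by (auto simp: det_mul)
qed

lemma abs_det_Sp:
  fixes S :: "real^('n::finite + 'n)^('n + 'n)"
  assumes "S \<in> Sp"
  shows "\<bar>det S\<bar> = 1"
proof -
  have "det (transpose S ** symp_J ** S) = det (symp_J :: real^('n + 'n)^('n + 'n))"
    using assms by (simp add: Sp_def)
  then have "(det S)\<^sup>2 = 1"
    using det_symp_J[where 'n = 'n] by (simp add: det_mul det_transpose power2_eq_square)
  then show ?thesis by (auto simp: power2_eq_1_iff)
qed

text \<open>The symplectic form pairs positions with momenta only, and the hypothesis says that this
  pairing is preserved: \<open>(B *v x) \<bullet> (C *v y) = x \<bullet> y\<close>.\<close>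

lemma block_diag_in_Sp:
  assumes "transpose B ** C = mat 1"
  shows "block_diag B C \<in> Sp"
proof -
  have BC: "(B *v x) \<bullet> (C *v y) = x \<bullet> y" for x y
    using assms by (metis inner_commute matrix_vector_mul_assoc matrix_vector_mul_lid transpose_mult_inner)
  have CB: "(C *v x) \<bullet> (B *v y) = x \<bullet> y" for x y
    using BC by (metis inner_commute)
  have "transpose (block_diag B C) ** symp_J ** block_diag B C = symp_J"
    by (rule matrix_eqI_inner)
       (simp only: matrix_vector_mul_assoc[symmetric] transpose_mult_inner, simp add: inner_phase BC CB)
  then show ?thesis by (simp add: Sp_def)
qed

section \<open>Ellipsoids as linear images of balls, and their volumes\<close>

lemma matrix_scaleR_vector: "(r *\<^sub>R A) *v x = r *\<^sub>R (A *v x)"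
  for A :: "real^'n::finite^'m::finite"
  by (simp add: matrix_vector_mult_def vec_eq_iff sum_distrib_left mult.assoc)

lemma invertible_scaleR:
  fixes A :: "real^'n::finite^'n"
  assumes "invertible A" "r \<noteq> 0"
  shows "invertible (r *\<^sub>R A)"
proof (rule matrix_inv_eqI(1))
  have "A *v (matrix_inv A *v x) = x" for x
    by (simp add: matrix_vector_mul_assoc matrix_mult_inv_right[OF assms(1)])
  then show "(r *\<^sub>R A) ** ((1 / r) *\<^sub>R matrix_inv A) = mat 1"
    unfolding matrix_eq matrix_vector_mul_assoc[symmetric] matrix_scaleR_vector
    using assms(2) by (simp add: matrix_vector_mult_scaleR)
qed

text \<open>Moves the radius into the matrix: blobs are images of a ball of radius
  \<open>sqrt hbar\<close>, whereas \<open>ellipsoid\<close> refers to the unit ball.\<close>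

lemma image_matrix_cball_scaleR:
  fixes A :: "real^'n::finite^'n"
  assumes "r > 0"
  shows "(\<lambda>z. A *v z) ` cball 0 r = (\<lambda>z. (r *\<^sub>R A) *v z) ` cball 0 1"
proof -
  have "cball 0 r = (*\<^sub>R) r ` cball (0 :: real^'n) 1"
    using assms by (subst cball_scale) auto
  then show ?thesis
    by (simp add: image_image matrix_vector_mult_scaleR matrix_scaleR_vector)
qed

lemma orthogonal_image_cball:
  fixes N :: "real^'n::finite^'n"
  assumes "N ** transpose N = mat 1"
  shows "(\<lambda>z. N *v z) ` cball 0 r = cball 0 r"
proof -
  have o: "orthogonal_matrix N"
    using assms by (simp add: orthogonal_matrix_def matrix_left_right_inverse)
  then have "orthogonal_transformation ((*v) N)"
    using orthogonal_transformation_matrix[of "(*v) N"] by simp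
  then show ?thesis
    using image_orthogonal_transformation_cball[of "(*v) N" 0 r] by simp
qed

text \<open>In the coordinates given by \<open>T\<close>, the rows of a competing ellipsoid have norm at most 1, so
  the comparison of volumes is Hadamard's inequality, and its equality case gives uniqueness.\<close>

lemma largest_inscribed_ellipsoid_linear_image:
  fixes T :: "real^'m::finite^'m"
  assumes T: "invertible T" and sub: "cball 0 1 \<subseteq> Q" and cube: "\<And>w i. w \<in> Q \<Longrightarrow> \<bar>w $ i\<bar> \<le> 1"
  shows "largest_inscribed_ellipsoid ((\<lambda>z. T *v z) ` Q) ((\<lambda>z. T *v z) ` cball 0 1)"
proof -
  let ?b = "cball (0 :: real^'m) 1"
  let ?E = "(\<lambda>z. T *v z) ` ?b"
  have "ellipsoid ?E"
    unfolding ellipsoid_def using T by (intro exI[of _ T] exI[of _ 0]) simp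
  moreover have "?E \<subseteq> (\<lambda>z. T *v z) ` Q" using sub by auto
  moreover have "measure lebesgue E' < measure lebesgue ?E"
    if E': "ellipsoid E'" "E' \<subseteq> (\<lambda>z. T *v z) ` Q" and ne: "E' \<noteq> ?E" for E'
  proof -
    obtain M c where M: "invertible M" and E'_eq: "E' = (\<lambda>z. c + M *v z) ` ?b"
      using E'(1) by (auto simp: ellipsoid_def)
    define U where "U = matrix_inv T"
    have U: "T ** U = mat 1" "U ** T = mat 1"
      using T by (simp_all add: U_def matrix_mult_inv_left matrix_mult_inv_right)
    \<comment> \<open>\<open>N\<close> and \<open>d\<close> are the matrix and the centre of
      \<open>E'\<close> in the coordinates given by \<open>T\<close>.\<close>
    define N where "N = U ** M"
    define d where "d = U *v c"
    have TN: "M = T ** N" and Td: "c = T *v d"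
      by (simp_all add: N_def d_def matrix_mul_assoc matrix_vector_mul_assoc U)
    have coord: "\<bar>d $ i + N $ i \<bullet> u\<bar> \<le> 1" if u: "norm u \<le> 1" for u i
    proof -
      have "c + M *v u \<in> (\<lambda>z. T *v z) ` Q"
        using E'(2) u by (auto simp: E'_eq)
      then obtain q where "q \<in> Q" "T *v (d + N *v u) = T *v q"
        by (auto simp: TN Td matrix_vector_right_distrib matrix_vector_mul_assoc)
      then have "d + N *v u \<in> Q"
        by (metis U(2) matrix_vector_mul_assoc matrix_vector_mul_lid)
      from cube[OF this, of i] show ?thesis
        by (simp add: matrix_vector_mul_component)
    qed
    \<comment> \<open>Coordinate \<open>i\<close> takes its extreme values on the ellipsoid at plus
      and minus the normalised row \<open>i\<close>; a vanishing row is covered by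
      \<open>sgn 0 = 0\<close>.\<close>
    have row: "\<bar>d $ i\<bar> + norm (N $ i) \<le> 1" for i
    proof -
      have "N $ i \<bullet> sgn (N $ i) = norm (N $ i)"
        by (cases "N $ i = 0") (simp_all add: sgn_div_norm power2_norm_eq_inner[symmetric] power2_eq_square)
      moreover have "norm (sgn (N $ i)) \<le> 1"
        by (simp add: norm_sgn)
      ultimately show ?thesis
        using coord[of "sgn (N $ i)" i] coord[of "- sgn (N $ i)" i] by simp
    qed
    then have rows: "norm (N $ i) \<le> 1" for i
      using row[of i] by linarith
    \<comment> \<open>With modulus 1 the rows would be unit vectors, \<open>row\<close> would force
      the centre \<open>d\<close> to be 0, and the orthogonal \<open>N\<close> would map the ball
      onto itself, so \<open>E'\<close> would equal \<open>?E\<close>.\<close>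
    have N1: "\<bar>det N\<bar> \<noteq> 1"
    proof
      assume "\<bar>det N\<bar> = 1"
      then have NN: "N ** transpose N = mat 1"
        by (rule hadamard_det_le_1(2)[OF rows])
      have "norm (N $ i) = 1" for i
      proof -
        have "N $ i \<bullet> N $ i = (N ** transpose N) $ i $ i"
          by (simp add: matrix_matrix_mult_def transpose_def inner_vec_def)
        then show ?thesis by (simp add: NN mat_def norm_eq_1)
      qed
      with row have "d = 0" by (auto simp: vec_eq_iff)
      then have "E' = (\<lambda>z. T *v z) ` (\<lambda>z. N *v z) ` ?b"
        by (simp add: E'_eq TN Td image_image matrix_vector_mul_assoc)
      with ne orthogonal_image_cball[OF NN] show False by simp
    qed
    then have "\<bar>det N\<bar> < 1"
      using hadamard_det_le_1(1)[OF rows] by simp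
    moreover have "measure lebesgue E' = \<bar>det T\<bar> * \<bar>det N\<bar> * measure lebesgue ?b"
      unfolding E'_eq by (subst measure_lebesgue_affine_image[OF M]) (auto simp: TN det_mul abs_mult)
    moreover have "measure lebesgue ?E = \<bar>det T\<bar> * measure lebesgue ?b"
      using measure_lebesgue_affine_image[OF T, of ?b 0] by simp
    moreover have "measure lebesgue ?b > 0"
      using content_cball_pos[of 1 "0 :: real^'m"] by simp
    moreover have "\<bar>det T\<bar> > 0"
      using T by (simp add: invertible_det_nz)
    ultimately show ?thesis by simp
  qed
  ultimately show ?thesis by (simp add: largest_inscribed_ellipsoid_def)
qed

text \<open>Symplectic matrices have determinant of modulus 1. Two blobs therefore never differ in
  volume, which is what turns strict maximality of one inscribed blob into its uniqueness.\<close>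

lemma quantum_blob_ellipsoid:
  fixes \<Omega> :: "(real^('n::finite + 'n)) set"
  assumes "hbar > 0" "quantum_blob hbar \<Omega>"
  shows "ellipsoid \<Omega>"
    and "measure lebesgue \<Omega> = measure lebesgue (cball (0 :: real^('n + 'n)) (sqrt hbar))"
proof -
  obtain S where S: "S \<in> Sp" "\<Omega> = (\<lambda>z. S *v z) ` cball 0 (sqrt hbar)"
    using assms by (auto simp: quantum_blob_def)
  have d: "\<bar>det S\<bar> = 1" by (rule abs_det_Sp[OF S(1)])
  then have i: "invertible S" by (auto simp: invertible_det_nz)
  have i': "invertible (sqrt hbar *\<^sub>R S)"
    using i assms(1) by (simp add: invertible_scaleR)
  show "ellipsoid \<Omega>"
    unfolding ellipsoid_def using i' assms(1)
    by (intro exI[of _ "sqrt hbar *\<^sub>R S"] exI[of _ 0])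
      (simp add: S(2) image_matrix_cball_scaleR[of "sqrt hbar"])
  show "measure lebesgue \<Omega> = measure lebesgue (cball (0 :: real^('n + 'n)) (sqrt hbar))"
    using measure_lebesgue_affine_image[OF i, of "cball 0 (sqrt hbar)" 0] d by (simp add: S(2))
qed

subsection \<open>Gaussian integrals\<close>

text \<open>The product form suits \<open>integral_lborel_vec_prod\<close>; the radial form is
  \<open>std_gauss_eq\<close>.\<close>

definition std_gauss :: "real^'n::finite \<Rightarrow> real" where
  "std_gauss u = (\<Prod>i\<in>UNIV. std_normal_density (u $ i))"

lemma power2_norm_vec: "(norm u)\<^sup>2 = (\<Sum>i\<in>UNIV. (u $ i)\<^sup>2)"
  for u :: "real^'n::finite"
  by (simp add: norm_vec_def L2_set_def sum_nonneg)

lemma std_gauss_eq: "std_gauss u = (1 / sqrt (2 * pi)) ^ CARD('n) * exp (- (norm u)\<^sup>2 / 2)"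
  for u :: "real^'n::finite"
proof -
  have "- (norm u)\<^sup>2 / 2 = (\<Sum>i\<in>UNIV. - (u $ i)\<^sup>2 / 2)"
    by (simp add: power2_norm_vec sum_negf sum_divide_distrib)
  then show ?thesis
    by (simp only: std_gauss_def std_normal_density_def prod.distrib exp_sum[OF finite] prod_constant)
qed

lemma
  fixes e :: "'n::finite \<Rightarrow> nat"
  shows integrable_std_gauss_moment: "integrable lborel (\<lambda>u::real^'n. std_gauss u * (\<Prod>i\<in>UNIV. u $ i ^ e i))"
    and integral_std_gauss_moment: "(\<integral>u. std_gauss (u::real^'n) * (\<Prod>i\<in>UNIV. u $ i ^ e i) \<partial>lborel)
      = (\<Prod>i\<in>UNIV. \<integral>x. std_normal_density x * x ^ e i \<partial>lborel)"
  using integrable_lborel_vec_prod[of "\<lambda>i x. std_normal_density x * x ^ e i"]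
    integral_lborel_vec_prod[of "\<lambda>i x. std_normal_density x * x ^ e i"] integrable_std_normal_moment
  by (simp_all add: std_gauss_def prod.distrib)

lemma integral_std_normal_moments:
  "(\<integral>x. std_normal_density x \<partial>lborel) = 1"
  "(\<integral>x. std_normal_density x * x \<partial>lborel) = 0"
  "(\<integral>x. std_normal_density x * x\<^sup>2 \<partial>lborel) = 1"
  using integral_std_normal_moment_even[of 0] integral_std_normal_moment_odd[of 0]
    integral_std_normal_moment_even[of 1]
  by simp_all

text \<open>A coordinate as a monomial with 0-1 exponents, which makes first and second moments
  instances of \<open>integral_std_gauss_moment\<close>.\<close>

lemma nth_eq_prod_power: "u $ k = (\<Prod>i\<in>UNIV. u $ i ^ of_bool (i = k))"
  for u :: "real^'n::finite"
proof -
  have "(\<Prod>i\<in>UNIV. u $ i ^ of_bool (i = k)) = (\<Prod>i\<in>UNIV. if i = k then u $ i else 1)"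
    by (rule prod.cong) auto
  then show ?thesis by simp
qed

lemma
  shows integrable_std_gauss: "integrable lborel (std_gauss :: real^'n::finite \<Rightarrow> real)"
    and integral_std_gauss: "(\<integral>u. std_gauss (u::real^'n) \<partial>lborel) = 1"
  using integrable_std_gauss_moment[of "\<lambda>_. 0"] integral_std_gauss_moment[of "\<lambda>_. 0"]
  by (simp_all add: integral_std_normal_moments)

lemma
  fixes k :: "'n::finite"
  shows integrable_std_gauss_nth: "integrable lborel (\<lambda>u::real^'n. std_gauss u * u $ k)"
    and integral_std_gauss_nth: "(\<integral>u. std_gauss (u::real^'n) * u $ k \<partial>lborel) = 0"
proof -
  show "integrable lborel (\<lambda>u::real^'n. std_gauss u * u $ k)"
    by (subst nth_eq_prod_power) (rule integrable_std_gauss_moment)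
  have "(\<integral>u. std_gauss (u::real^'n) * u $ k \<partial>lborel)
      = (\<Prod>i\<in>UNIV. \<integral>x. std_normal_density x * x ^ of_bool (i = k) \<partial>lborel)"
    by (subst nth_eq_prod_power) (rule integral_std_gauss_moment)
  also have "\<dots> = 0"
    by (rule prod_zero) (auto intro!: bexI[of _ k] simp: integral_std_normal_moments)
  finally show "(\<integral>u. std_gauss (u::real^'n) * u $ k \<partial>lborel) = 0" .
qed

lemma
  fixes k l :: "'n::finite"
  shows integrable_std_gauss_nth2: "integrable lborel (\<lambda>u::real^'n. std_gauss u * (u $ k * u $ l))"
    and integral_std_gauss_nth2:
      "(\<integral>u. std_gauss (u::real^'n) * (u $ k * u $ l) \<partial>lborel) = of_bool (k = l)"
proof -
  have eq: "u $ k * u $ l = (\<Prod>i\<in>UNIV. u $ i ^ (of_bool (i = k) + of_bool (i = l)))" for u :: "real^'n"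
    by (simp add: power_add prod.distrib flip: nth_eq_prod_power)
  show "integrable lborel (\<lambda>u::real^'n. std_gauss u * (u $ k * u $ l))"
    unfolding eq by (rule integrable_std_gauss_moment)
  have "(\<integral>u. std_gauss (u::real^'n) * (u $ k * u $ l) \<partial>lborel)
      = (\<Prod>i\<in>UNIV. \<integral>x. std_normal_density x * x ^ (of_bool (i = k) + of_bool (i = l)) \<partial>lborel)"
    unfolding eq by (rule integral_std_gauss_moment)
  also have "\<dots> = of_bool (k = l)"
  proof (cases "k = l")
    case True
    have "(\<integral>x. std_normal_density x * x ^ (of_bool (i = k) + of_bool (i = k)) \<partial>lborel) = 1" for i
      by (cases "i = k") (simp_all add: integral_std_normal_moments flip: power2_eq_square)
    then show ?thesis by (simp add: True)
  next
    case False
    then have "(\<Prod>i\<in>UNIV. \<integral>x. std_normal_density x * x ^ (of_bool (i = k) + of_bool (i = l)) \<partial>lborel) = 0"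
      by (intro prod_zero) (auto intro!: bexI[of _ k] simp: integral_std_normal_moments)
    then show ?thesis using False by simp
  qed
  finally show "(\<integral>u. std_gauss (u::real^'n) * (u $ k * u $ l) \<partial>lborel) = of_bool (k = l)" .
qed

text \<open>The integrand factors over the coordinates, and each factor integrates to a value of the
  characteristic function of the standard normal distribution.\<close>

lemma integral_std_gauss_iexp:
  fixes q :: "real^'n::finite"
  shows "(\<integral>u. complex_of_real (std_gauss u) * exp (\<i> * complex_of_real (q \<bullet> u)) \<partial>lborel)
    = complex_of_real (exp (- (norm q)\<^sup>2 / 2))"
proof -
  let ?f = "\<lambda>i x. complex_of_real (std_normal_density x) * exp (\<i> * complex_of_real (q $ i * x))"
  have "(\<integral>x. complex_of_real (std_normal_density x) * exp (\<i> * complex_of_real (t * x)) \<partial>lborel)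
      = char std_normal_distribution t" for t
    unfolding char_def by (subst integral_density) (auto simp: scaleR_conv_of_real)
  then have c: "(\<integral>x. ?f i x \<partial>lborel) = complex_of_real (exp (- (q $ i)\<^sup>2 / 2))" for i
    by (simp add: char_std_normal_distribution)
  have int: "integrable lborel (?f i)" for i
  proof (rule Bochner_Integration.integrable_bound)
    show "integrable lborel std_normal_density"
      using integrable_std_normal_moment[of 0] by simp
    show "AE x in lborel. norm (?f i x) \<le> norm (std_normal_density x)"
      by (simp add: norm_mult)
  qed simp
  have "complex_of_real (std_gauss u) * exp (\<i> * complex_of_real (q \<bullet> u)) = (\<Prod>i\<in>UNIV. ?f i (u $ i))" for u
    by (simp add: std_gauss_def inner_vec_def prod.distrib exp_sum sum_distrib_left)
  then have "(\<integral>u. complex_of_real (std_gauss u) * exp (\<i> * complex_of_real (q \<bullet> u)) \<partial>lborel)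
      = (\<Prod>i\<in>UNIV. \<integral>x. ?f i x \<partial>lborel)"
    using integral_lborel_vec_prod[of ?f, OF int] by simp
  also have "\<dots> = complex_of_real (exp (\<Sum>i\<in>UNIV. - (q $ i)\<^sup>2 / 2))"
    unfolding c by (simp add: exp_sum)
  also have "(\<Sum>i\<in>UNIV. - (q $ i)\<^sup>2 / 2) = - (norm q)\<^sup>2 / 2"
    by (simp add: power2_norm_vec sum_negf sum_divide_distrib)
  finally show ?thesis .
qed

lemma matrix_vector_nth: "(T *v u) $ i = (\<Sum>k\<in>UNIV. T $ i $ k * u $ k)"
  by (simp add: matrix_vector_mult_def)

text \<open>The hypothesis on \<open>g\<close> says that \<open>g\<close> is the density of
  \<open>T *v u\<close> for a standard Gaussian vector \<open>u\<close>. Substituting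
  \<open>z = T *v u\<close> expresses each moment through those of \<open>std_gauss\<close>.\<close>

lemma
  fixes T :: "real^'m::finite^'m" and g :: "real^'m \<Rightarrow> real"
  assumes T: "det T \<noteq> 0" and [measurable]: "g \<in> borel_measurable borel"
    and g: "\<And>u. \<bar>det T\<bar> * g (T *v u) = std_gauss u"
  shows integrable_gauss_image: "integrable lborel g"
    and integral_gauss_image: "integral\<^sup>L lborel g = 1"
    and integral_gauss_image_nth: "(\<integral>z. z $ i * g z \<partial>lborel) = 0"
    and integrable_gauss_image_nth2: "integrable lborel (\<lambda>z. z $ i * z $ j * g z)"
    and integral_gauss_image_nth2: "(\<integral>z. z $ i * z $ j * g z \<partial>lborel) = (T ** transpose T) $ i $ j"
proof -
  have g': "g (T *v u) = std_gauss u / \<bar>det T\<bar>" for u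
    using g[of u] T by (simp add: field_simps)
  have "integrable lborel (\<lambda>u. g (T *v u))"
    unfolding g' by (intro integrable_divide integrable_std_gauss)
  then show "integrable lborel g"
    by (subst (asm) integrable_lborel_linear_iff[OF T]) simp_all
  show "integral\<^sup>L lborel g = 1"
    using integral_lborel_linear[OF T, of g] integral_std_gauss T by (simp add: g')
  have "(\<integral>z. z $ i * g z \<partial>lborel) = \<bar>det T\<bar> * (\<integral>u. (T *v u) $ i * g (T *v u) \<partial>lborel)"
    using integral_lborel_linear[OF T, of "\<lambda>z. z $ i * g z"] by simp
  also have "(\<integral>u. (T *v u) $ i * g (T *v u) \<partial>lborel)
      = (\<integral>u. (\<Sum>k\<in>UNIV. (T $ i $ k / \<bar>det T\<bar>) * (std_gauss u * u $ k)) \<partial>lborel)"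
  proof -
    have "(T *v u) $ i * g (T *v u) = (\<Sum>k\<in>UNIV. (T $ i $ k / \<bar>det T\<bar>) * (std_gauss u * u $ k))" for u
      by (simp add: g' matrix_vector_nth sum_distrib_right sum_distrib_left sum_divide_distrib mult_ac)
    then show ?thesis by simp
  qed
  also have "\<dots> = 0"
    by (simp add: integrable_std_gauss_nth integral_std_gauss_nth)
  finally show "(\<integral>z. z $ i * g z \<partial>lborel) = 0" by simp
  have eq: "(T *v u) $ i * (T *v u) $ j * g (T *v u)
      = (\<Sum>k\<in>UNIV. \<Sum>l\<in>UNIV. (T $ i $ k * T $ j $ l / \<bar>det T\<bar>) * (std_gauss u * (u $ k * u $ l)))" for u
  proof -
    have "(T *v u) $ i * (T *v u) $ j = (\<Sum>k\<in>UNIV. \<Sum>l\<in>UNIV. (T $ i $ k * u $ k) * (T $ j $ l * u $ l))"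
      unfolding matrix_vector_nth sum_product ..
    then show ?thesis
      unfolding g' by (simp only: sum_distrib_right) (intro sum.cong refl, simp)
  qed
  show "integrable lborel (\<lambda>z. z $ i * z $ j * g z)"
    using integrable_lborel_linear_iff[OF T, of "\<lambda>z. z $ i * z $ j * g z"]
    by (simp add: eq integrable_std_gauss_nth2)
  have "(\<integral>z. z $ i * z $ j * g z \<partial>lborel)
      = \<bar>det T\<bar> * (\<integral>u. (T *v u) $ i * (T *v u) $ j * g (T *v u) \<partial>lborel)"
    using integral_lborel_linear[OF T, of "\<lambda>z. z $ i * z $ j * g z"] by simp
  also have "\<dots> = \<bar>det T\<bar> * (\<Sum>k\<in>UNIV. \<Sum>l\<in>UNIV. (T $ i $ k * T $ j $ l / \<bar>det T\<bar>) * of_bool (k = l))"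
    unfolding eq by (simp add: integrable_std_gauss_nth2 integral_std_gauss_nth2)
  also have "\<dots> = (\<Sum>k\<in>UNIV. T $ i $ k * T $ j $ k)"
    using T by (simp add: of_bool_def if_distrib sum_distrib_left cong: if_cong)
  also have "\<dots> = (T ** transpose T) $ i $ j"
    by (simp add: matrix_matrix_mult_def transpose_def)
  finally show "(\<integral>z. z $ i * z $ j * g z \<partial>lborel) = (T ** transpose T) $ i $ j" .
qed

text \<open>If \<open>K\<close> is the inverse of \<open>L\<close>, then
  \<open>transpose K ** K\<close> is the inverse of \<open>L ** transpose L\<close>, and its
  quadratic form at \<open>L *v u\<close> is the squared norm of
  \<open>K *v (L *v u) = u\<close>.\<close>

lemma matrix_inv_mult_transpose_quadratic:
  fixes L :: "real^'n::finite^'n"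
  assumes L: "det L \<noteq> 0"
  shows "invertible (L ** transpose L)"
    and "(matrix_inv (L ** transpose L) *v (L *v u)) \<bullet> (L *v u) = (norm u)\<^sup>2"
proof -
  have iL: "invertible L" using L by (simp add: invertible_det_nz)
  define K where "K = matrix_inv L"
  have K: "L ** K = mat 1" "K ** L = mat 1"
    using iL by (simp_all add: K_def matrix_mult_inv_left matrix_mult_inv_right)
  have "transpose L ** transpose K = mat 1"
    using K(2) by (metis matrix_transpose_mul transpose_mat)
  then have LK: "L ** transpose L ** (transpose K ** K) = mat 1"
    by (metis K(1) matrix_mul_assoc matrix_mul_rid)
  then show "invertible (L ** transpose L)"
    by (rule matrix_inv_eqI)
  have "(transpose K ** K *v (L *v u)) \<bullet> (L *v u) = (K *v (L *v u)) \<bullet> (K *v (L *v u))"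
    by (simp only: matrix_vector_mul_assoc[symmetric] transpose_mult_inner)
  also have "\<dots> = (norm u)\<^sup>2"
    by (simp add: matrix_vector_mul_assoc K power2_norm_eq_inner)
  finally show "(matrix_inv (L ** transpose L) *v (L *v u)) \<bullet> (L *v u) = (norm u)\<^sup>2"
    by (simp add: matrix_inv_eqI(2)[OF LK])
qed

subsection \<open>Gaussian states\<close>

lemma borel_measurable_cnj [measurable]: "cnj \<in> borel_measurable borel"
  using borel_measurable_continuous_onI[OF continuous_on_cnj[OF continuous_on_id]] by simp

lemma borel_measurable_gaussian_state [measurable]: "gaussian_state \<Sigma> \<in> borel_measurable borel"
proof (rule borel_measurable_continuous_onI)
  show "continuous_on UNIV (gaussian_state \<Sigma>)"
    unfolding gaussian_state_def
    by (intro continuous_intros continuous_on_compose2[OF matrix_vector_mult_linear_continuous_on[of UNIV]]) auto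
qed

lemma det_scaleR:
  fixes A :: "real^'n::finite^'n"
  shows "det (r *\<^sub>R A) = r ^ CARD('n) * det A"
proof -
  have "r *\<^sub>R A = (\<chi> i. r *s A $ i)"
    by (simp add: vec_eq_iff)
  then show ?thesis
    using det_rows_mul[of "\<lambda>_. r" "\<lambda>i. A $ i"] by simp
qed

text \<open>The squared state is the density of \<open>L *v u\<close> for a standard Gaussian
  \<open>u\<close>: squaring turns the quarter powers into the normalisation of
  \<open>std_gauss\<close> and the Jacobian \<open>1 / \<bar>det L\<bar>\<close>. The state is the
  nonnegative root.\<close>

lemma gaussian_state_linear:
  fixes L :: "real^'n::finite^'n"
  assumes L: "det L \<noteq> 0"
  shows "gaussian_state (L ** transpose L) (L *v u) = complex_of_real (sqrt (std_gauss u / \<bar>det L\<bar>))"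
proof -
  define s where "s = (1 / (2 * pi)) powr (real CARD('n) / 4) * \<bar>det L\<bar> powr (-1/2) * exp (- (norm u)\<^sup>2 / 4)"
  have "det (L ** transpose L) = \<bar>det L\<bar> powr 2"
    using L by (simp add: det_mul power2_eq_square)
  then have "det (L ** transpose L) powr (-1/4) = \<bar>det L\<bar> powr (-1/2)"
    by (simp only: powr_powr) simp
  then have "gaussian_state (L ** transpose L) (L *v u) = complex_of_real s"
    by (simp add: gaussian_state_def s_def matrix_inv_mult_transpose_quadratic[OF L])
  moreover have "s = sqrt (std_gauss u / \<bar>det L\<bar>)"
  proof (rule real_sqrt_unique[symmetric])
    show "0 \<le> s" by (simp add: s_def)
    have "((1 / (2 * pi)) powr (real CARD('n) / 4))\<^sup>2 = (1 / (2 * pi)) powr (1/2 * real CARD('n))"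
      by (simp add: power2_eq_square flip: powr_add)
    also have "\<dots> = (1 / sqrt (2 * pi)) ^ CARD('n)"
      by (simp only: powr_powr[symmetric], subst powr_realpow)
         (simp_all add: powr_half_sqrt real_sqrt_divide)
    finally have 1: "((1 / (2 * pi)) powr (real CARD('n) / 4))\<^sup>2 = (1 / sqrt (2 * pi)) ^ CARD('n)" .
    have 2: "(\<bar>det L\<bar> powr (-1/2))\<^sup>2 = 1 / \<bar>det L\<bar>"
      using L by (simp add: power2_eq_square powr_minus_divide flip: powr_add)
    have 3: "(exp (- (norm u)\<^sup>2 / 4))\<^sup>2 = exp (- (norm u)\<^sup>2 / 2)"
      by (simp add: power2_eq_square flip: exp_add)
    show "s\<^sup>2 = std_gauss u / \<bar>det L\<bar>"
      unfolding s_def power_mult_distrib 1 2 3 by (simp add: std_gauss_eq)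
  qed
  ultimately show ?thesis by simp
qed

lemma std_gauss_pos: "std_gauss u > 0"
  by (simp add: std_gauss_eq)

text \<open>The parallelogram law in the exponent. It separates the two shifted states in the Wigner
  integral into a constant depending on \<open>a\<close> and a standard Gaussian in
  \<open>v\<close>.\<close>

lemma sqrt_std_gauss_mult:
  fixes a v :: "real^'n::finite"
  shows "sqrt (std_gauss (a + v)) * sqrt (std_gauss (a - v)) = exp (- (norm a)\<^sup>2 / 2) * std_gauss v"
proof -
  have "(norm (a + v))\<^sup>2 + (norm (a - v))\<^sup>2 = 2 * (norm a)\<^sup>2 + 2 * (norm v)\<^sup>2"
    by (simp add: power2_norm_eq_inner inner_add_left inner_add_right inner_diff_left inner_diff_right)
  then have "exp (- (norm (a + v))\<^sup>2 / 2) * exp (- (norm (a - v))\<^sup>2 / 2) = exp (- (norm a)\<^sup>2 - (norm v)\<^sup>2)"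
    by (simp add: field_simps flip: exp_add)
  also have "\<dots> = (exp (- (norm a)\<^sup>2 / 2) * exp (- (norm v)\<^sup>2 / 2))\<^sup>2"
  proof -
    have "exp (- x - y) = (exp (- x / 2) * exp (- y / 2))\<^sup>2" for x y :: real
    proof -
      have "(exp (- x / 2) * exp (- y / 2))\<^sup>2 = exp (2 * (- x / 2 + - y / 2))"
        unfolding exp_double exp_add ..
      also have "2 * (- x / 2 + - y / 2) = - x - y" by simp
      finally show ?thesis by simp
    qed
    then show ?thesis .
  qed
  finally have e: "exp (- (norm (a + v))\<^sup>2 / 2) * exp (- (norm (a - v))\<^sup>2 / 2)
      = (exp (- (norm a)\<^sup>2 / 2) * exp (- (norm v)\<^sup>2 / 2))\<^sup>2" .
  \<comment> \<open>\<open>c\<close> stands for the normalising constant of \<open>std_gauss\<close>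
    and the other variables for exponentials, which leaves a purely algebraic identity.\<close>
  have "(x * (c * y))\<^sup>2 = (c * s) * (c * t)" if "s * t = (x * y)\<^sup>2" for x y c s t :: real
  proof -
    have "(c * s) * (c * t) = c\<^sup>2 * (s * t)" by (simp add: power2_eq_square)
    then show ?thesis by (simp add: that power_mult_distrib)
  qed
  from this[OF e] have sq: "(exp (- (norm a)\<^sup>2 / 2) * std_gauss v)\<^sup>2 = std_gauss (a + v) * std_gauss (a - v)"
    unfolding std_gauss_eq by blast
  have "0 \<le> exp (- (norm a)\<^sup>2 / 2) * std_gauss v"
    using std_gauss_pos[of v] by simp
  from real_sqrt_unique[OF sq this] show ?thesis
    by (simp only: real_sqrt_mult)
qed

text \<open>After the substitution \<open>y = (2 *\<^sub>R L) *v v\<close> the two states contribute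
  a factor in \<open>a\<close> and \<open>std_gauss v\<close>, so the remaining integral is the
  Fourier transform of a standard Gaussian.\<close>

lemma wigner_gaussian_state:
  fixes L :: "real^'n::finite^'n" and z :: "real^('n + 'n)"
  assumes h: "hbar > 0" and L: "det L \<noteq> 0" and z: "pos_proj z = L *v a"
  shows "wigner hbar (gaussian_state (L ** transpose L)) z = complex_of_real
    ((1 / (pi * hbar)) ^ CARD('n) *
      exp (- ((norm a)\<^sup>2 + (norm ((2 / hbar) *\<^sub>R (transpose L *v mom_proj z)))\<^sup>2) / 2))"
proof -
  let ?\<psi> = "gaussian_state (L ** transpose L)"
  define p where "p = mom_proj z"
  \<comment> \<open>Chosen so that the phase \<open>- (p \<bullet> y) / hbar\<close> becomes
    \<open>q \<bullet> v\<close> under the substitution.\<close>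
  define q where "q = - (2 / hbar) *\<^sub>R (transpose L *v p)"
  define F where "F y = exp (- (\<i> / complex_of_real hbar) * complex_of_real (p \<bullet> y)) *
        ?\<psi> (L *v a + (1/2) *\<^sub>R y) * cnj (?\<psi> (L *v a - (1/2) *\<^sub>R y))" for y
  have [measurable]: "F \<in> borel_measurable borel"
    unfolding F_def by measurable
  have d2: "det (2 *\<^sub>R L) \<noteq> 0" using L by (simp add: det_scaleR)
  have F2: "F ((2 *\<^sub>R L) *v v) = complex_of_real (exp (- (norm a)\<^sup>2 / 2) / \<bar>det L\<bar>) *
      (complex_of_real (std_gauss v) * exp (\<i> * complex_of_real (q \<bullet> v)))" for v
  proof -
    have \<psi>: "?\<psi> (L *v a + (1/2) *\<^sub>R ((2 *\<^sub>R L) *v v)) = complex_of_real (sqrt (std_gauss (a + v) / \<bar>det L\<bar>))"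
      "?\<psi> (L *v a - (1/2) *\<^sub>R ((2 *\<^sub>R L) *v v)) = complex_of_real (sqrt (std_gauss (a - v) / \<bar>det L\<bar>))"
      using gaussian_state_linear[OF L, of "a + v"] gaussian_state_linear[OF L, of "a - v"]
      by (simp_all add: matrix_scaleR_vector matrix_vector_right_distrib matrix_vector_mult_diff_distrib)
    have "p \<bullet> ((2 *\<^sub>R L) *v v) = - hbar * (q \<bullet> v)"
      using h by (simp only: q_def matrix_scaleR_vector inner_scaleR_left inner_scaleR_right transpose_mult_inner) simp
    then have "- (\<i> / complex_of_real hbar) * complex_of_real (p \<bullet> ((2 *\<^sub>R L) *v v))
        = \<i> * complex_of_real (q \<bullet> v)"
      using h by (simp only: of_real_mult of_real_minus) simp
    then have e: "exp (- (\<i> / complex_of_real hbar) * complex_of_real (p \<bullet> ((2 *\<^sub>R L) *v v)))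
        = exp (\<i> * complex_of_real (q \<bullet> v))"
      by (rule arg_cong)
    have "sqrt (std_gauss (a + v) / \<bar>det L\<bar>) * sqrt (std_gauss (a - v) / \<bar>det L\<bar>)
        = exp (- (norm a)\<^sup>2 / 2) / \<bar>det L\<bar> * std_gauss v"
      using sqrt_std_gauss_mult[of a v] by (simp add: real_sqrt_divide)
    then have s: "complex_of_real (sqrt (std_gauss (a + v) / \<bar>det L\<bar>)) * complex_of_real (sqrt (std_gauss (a - v) / \<bar>det L\<bar>))
        = complex_of_real (exp (- (norm a)\<^sup>2 / 2) / \<bar>det L\<bar>) * complex_of_real (std_gauss v)"
      by (simp only: of_real_mult[symmetric])
    show ?thesis
      unfolding F_def \<psi> e complex_cnj_complex_of_real mult.assoc s
      by (simp only: mult_ac)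
  qed
  have "(LINT y|lebesgue. F y) = (\<integral>y. F y \<partial>lborel)"
    by (rule integral_completion) simp
  also have "\<dots> = \<bar>det (2 *\<^sub>R L)\<bar> *\<^sub>R (\<integral>v. F ((2 *\<^sub>R L) *v v) \<partial>lborel)"
    by (rule integral_lborel_linear[OF d2]) simp
  \<comment> \<open>The Jacobian cancels the \<open>1 / \<bar>det L\<bar>\<close> of the states up
    to \<open>2 ^ CARD('n)\<close>, which later changes the prefactor from
    \<open>1 / (2 * pi * hbar)\<close> to \<open>1 / (pi * hbar)\<close>.\<close>
  also have "\<dots> = complex_of_real (2 ^ CARD('n) * exp (- (norm a)\<^sup>2 / 2) * exp (- (norm q)\<^sup>2 / 2))"
  proof -
    have "(\<integral>v. F ((2 *\<^sub>R L) *v v) \<partial>lborel)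
        = complex_of_real (exp (- (norm a)\<^sup>2 / 2) / \<bar>det L\<bar>) * complex_of_real (exp (- (norm q)\<^sup>2 / 2))"
      unfolding F2 integral_mult_right_zero integral_std_gauss_iexp ..
    moreover have "\<bar>det (2 *\<^sub>R L)\<bar> * (exp (- (norm a)\<^sup>2 / 2) / \<bar>det L\<bar> * exp (- (norm q)\<^sup>2 / 2))
        = 2 ^ CARD('n) * exp (- (norm a)\<^sup>2 / 2) * exp (- (norm q)\<^sup>2 / 2)"
      using L by (simp add: det_scaleR abs_mult)
    ultimately show ?thesis
      by (simp only: scaleR_conv_of_real of_real_mult[symmetric])
  qed
  finally have I: "(LINT y|lebesgue. F y) = \<dots>" .
  have "wigner hbar ?\<psi> z = complex_of_real ((1 / (2 * pi * hbar)) ^ CARD('n)) * (LINT y|lebesgue. F y)"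
    unfolding wigner_def F_def p_def z ..
  also note I
  also have "complex_of_real ((1 / (2 * pi * hbar)) ^ CARD('n)) *
      complex_of_real (2 ^ CARD('n) * exp (- (norm a)\<^sup>2 / 2) * exp (- (norm q)\<^sup>2 / 2))
    = complex_of_real ((1 / (pi * hbar)) ^ CARD('n) * (exp (- (norm a)\<^sup>2 / 2) * exp (- (norm q)\<^sup>2 / 2)))"
    by (simp add: power_divide power_mult_distrib)
  also have "exp (- (norm a)\<^sup>2 / 2) * exp (- (norm q)\<^sup>2 / 2) = exp (- ((norm a)\<^sup>2 + (norm q)\<^sup>2) / 2)"
    by (simp add: add_divide_distrib flip: exp_add)
  also have "norm q = norm ((2 / hbar) *\<^sub>R (transpose L *v mom_proj z))"
    by (simp only: q_def p_def scaleR_minus_left norm_minus_cancel)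
  finally show ?thesis .
qed

text \<open>The Wigner transform is the density of \<open>T *v u\<close> for a standard Gaussian
  \<open>u\<close> on phase space, so the covariance ellipsoid is the image under \<open>T\<close>
  of the ball of radius \<open>sqrt 2\<close>. The factor \<open>sqrt (hbar / 2)\<close> in
  \<open>T\<close> turns that radius into \<open>sqrt hbar\<close>.\<close>

lemma covariance_ellipsoid_gaussian_state:
  fixes B C :: "real^'n::finite^'n"
  assumes h: "hbar > 0" and BC: "transpose B ** C = mat 1"
  shows "is_covariance_ellipsoid hbar (gaussian_state ((hbar / 2) *\<^sub>R (B ** transpose B)))
    ((\<lambda>z. block_diag B C *v z) ` cball 0 (sqrt hbar))"
proof -
  define r where "r = sqrt (hbar / 2)"
  have r: "r > 0" "r * r = hbar / 2" "r\<^sup>2 = hbar / 2" using h by (simp_all add: r_def)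
  define L where "L = r *\<^sub>R B"
  define T where "T = r *\<^sub>R block_diag B C"
  have "det B \<noteq> 0"
    using arg_cong[OF BC, of det] by (auto simp: det_mul)
  then have L: "det L \<noteq> 0" using r by (simp add: L_def det_scaleR)
  have LL: "(hbar / 2) *\<^sub>R (B ** transpose B) = L ** transpose L"
    using r by (simp add: L_def vec_eq_iff matrix_matrix_mult_def transpose_def sum_distrib_left mult_ac
        flip: r(2))
  define \<psi> where "\<psi> = gaussian_state (L ** transpose L)"
  have dT: "\<bar>det T\<bar> = (hbar / 2) ^ CARD('n)"
    using abs_det_Sp[OF block_diag_in_Sp[OF BC]] r(1)
    by (simp add: T_def det_scaleR abs_mult power_add flip: r(2) power_mult_distrib)
  then have T0: "det T \<noteq> 0" using h by auto
  then have iT: "invertible T" by (simp add: invertible_det_nz)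
  define U where "U = matrix_inv T"
  have UT: "T ** U = mat 1" "U ** T = mat 1"
    using iT by (simp_all add: U_def matrix_mult_inv_left matrix_mult_inv_right)
  \<comment> \<open>The explicit Wigner function; its constant is the one that makes
    \<open>\<bar>det T\<bar> * g (T *v u)\<close> equal to \<open>std_gauss u\<close>.\<close>
  define g where "g z = (1 / (pi * hbar)) ^ CARD('n) * exp (- (norm (U *v z))\<^sup>2 / 2)" for z
  have g_meas [measurable]: "g \<in> borel_measurable borel"
    unfolding g_def by measurable
  have UTu: "U *v (T *v u) = u" for u
    by (simp add: matrix_vector_mul_assoc UT)
  have TUu: "T *v (U *v z) = z" for z
    by (simp add: matrix_vector_mul_assoc UT)
  have W: "wigner hbar \<psi> z = complex_of_real (g z)" for z
  proof -
    define u where "u = U *v z"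
    have z: "z = T *v u" by (simp add: u_def TUu)
    have 1: "pos_proj z = L *v pos_proj u"
      by (simp add: z T_def L_def matrix_scaleR_vector)
    have "mom_proj z = r *\<^sub>R (C *v mom_proj u)"
      by (simp add: z T_def matrix_scaleR_vector)
    moreover have "transpose L = r *\<^sub>R transpose B"
      by (simp add: L_def transpose_def vec_eq_iff)
    \<comment> \<open>Here \<open>2 / hbar\<close> cancels against \<open>r * r = hbar / 2\<close>
      and \<open>transpose B\<close> against \<open>C\<close>, leaving the momentum part of
      \<open>u\<close>.\<close>
    ultimately have "(2 / hbar) *\<^sub>R (transpose L *v mom_proj z) = ((2 / hbar) * (r * r)) *\<^sub>R (transpose B ** C *v mom_proj u)"
      by (simp only: matrix_scaleR_vector matrix_vector_mult_scaleR scaleR_scaleR matrix_vector_mul_assoc[symmetric] mult.assoc)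
    also have "\<dots> = mom_proj u"
      using h by (simp add: BC r)
    finally have 2: "(2 / hbar) *\<^sub>R (transpose L *v mom_proj z) = mom_proj u" .
    show ?thesis
      unfolding \<psi>_def wigner_gaussian_state[OF h L 1] 2 g_def u_def[symmetric] norm_phase[of u] ..
  qed
  have gT: "\<bar>det T\<bar> * g (T *v u) = std_gauss u" for u :: "real^('n + 'n)"
  proof -
    have "(1 / sqrt (2 * pi)) ^ CARD('n + 'n) = ((1 / sqrt (2 * pi)) * (1 / sqrt (2 * pi))) ^ CARD('n)"
      by (simp only: card_sum power_add power_mult_distrib)
    also have "(1 / sqrt (2 * pi)) * (1 / sqrt (2 * pi)) = hbar / 2 * (1 / (pi * hbar))"
      using h by simp
    also have "\<dots> ^ CARD('n) = (hbar / 2) ^ CARD('n) * (1 / (pi * hbar)) ^ CARD('n)"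
      by (rule power_mult_distrib)
    finally show ?thesis
      by (simp only: g_def UTu dT std_gauss_eq mult.assoc)
  qed
  note gi = integrable_gauss_image[OF T0 g_meas gT]
    integral_gauss_image_nth[OF T0 g_meas gT]
    integrable_gauss_image_nth2[OF T0 g_meas gT] integral_gauss_image_nth2[OF T0 g_meas gT]
  have leb: "(LINT z|lebesgue. complex_of_real (f z)) = complex_of_real (\<integral>z. f z \<partial>lborel)"
    if "f \<in> borel_measurable borel" for f :: "real^('n + 'n) \<Rightarrow> real"
    using that by (subst integral_completion) simp_all
  have cov: "covariance_matrix hbar \<psi> = T ** transpose T"
  proof -
    have "(LINT z|lebesgue. (z $ i * z $ j) *\<^sub>R wigner hbar \<psi> z) = complex_of_real ((T ** transpose T) $ i $ j)" for i j
      using leb[of "\<lambda>z. z $ i * z $ j * g z"] gi(4)[of i j] by (simp add: W scaleR_conv_of_real)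
    then show ?thesis
      by (simp add: covariance_matrix_def vec_eq_iff)
  qed
  have \<psi>_meas: "\<psi> \<in> borel_measurable borel" by (simp add: \<psi>_def)
  have \<psi>L: "\<bar>det L\<bar> * (norm (\<psi> (L *v u)))\<^sup>2 = std_gauss u" for u
    using gaussian_state_linear[OF L, of u] L std_gauss_pos[of u]
    by (simp add: \<psi>_def)
  have \<psi>2_meas: "(\<lambda>x. (norm (\<psi> x))\<^sup>2) \<in> borel_measurable borel"
    using \<psi>_meas by measurable
  have \<psi>2: "integrable lborel (\<lambda>x. (norm (\<psi> x))\<^sup>2)" "(\<integral>x. (norm (\<psi> x))\<^sup>2 \<partial>lborel) = 1"
    using integrable_gauss_image[OF L \<psi>2_meas \<psi>L] integral_gauss_image[OF L \<psi>2_meas \<psi>L] by simp_all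
  have "centered_state hbar \<psi>"
    unfolding centered_state_def square_integrable_def
  proof (intro conjI allI)
    show "\<psi> \<in> borel_measurable lebesgue"
      using \<psi>_meas by (simp add: measurable_completion)
    show "integrable lebesgue (\<lambda>x. (norm (\<psi> x))\<^sup>2)"
      using \<psi>2(1) \<psi>2_meas by (simp add: integrable_completion)
    show "(LINT x|lebesgue. (norm (\<psi> x))\<^sup>2) = 1"
      using \<psi>2(2) \<psi>2_meas by (simp add: integral_completion)
    show "(LINT z|lebesgue. (z $ i) *\<^sub>R wigner hbar \<psi> z) = 0" for i
      using leb[of "\<lambda>z. z $ i * g z"] gi(2)[of i] by (simp add: W scaleR_conv_of_real)
    \<comment> \<open>The weighted function is \<open>g\<close> plus the integrands of the diagonal
      second moments, all known to be integrable.\<close>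
    have "(1 + (norm z)\<^sup>2) *\<^sub>R wigner hbar \<psi> z = complex_of_real (g z + (\<Sum>i\<in>UNIV. z $ i * z $ i * g z))" for z
    proof -
      have "(1 + (norm z)\<^sup>2) * g z = g z + (\<Sum>i\<in>UNIV. z $ i * z $ i * g z)"
        by (simp only: power2_norm_vec sum_distrib_right distrib_right mult_1_left)
          (simp only: power2_eq_square)
      then show ?thesis
        by (simp only: W scaleR_conv_of_real of_real_mult[symmetric])
    qed
    moreover have "integrable lborel (\<lambda>z. complex_of_real (g z + (\<Sum>i\<in>UNIV. z $ i * z $ i * g z)))"
      using gi(1,3) by (intro integrable_of_real Bochner_Integration.integrable_add Bochner_Integration.integrable_sum)
    ultimately show "integrable lebesgue (\<lambda>z. (1 + (norm z)\<^sup>2) *\<^sub>R wigner hbar \<psi> z)"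
      by (simp add: integrable_completion)
  qed
  moreover have "(\<lambda>z. block_diag B C *v z) ` cball 0 (sqrt hbar)
      = {z. (1/2) * ((matrix_inv (covariance_matrix hbar \<psi>) *v z) \<bullet> z) \<le> 1}"
  proof -
    have q: "(matrix_inv (covariance_matrix hbar \<psi>) *v (T *v u)) \<bullet> (T *v u) = (norm u)\<^sup>2" for u
      unfolding cov by (rule matrix_inv_mult_transpose_quadratic[OF T0])
    have n: "(1/2) * (norm u)\<^sup>2 \<le> 1 \<longleftrightarrow> norm (r *\<^sub>R u) \<le> sqrt hbar" for u :: "real^('n + 'n)"
    proof -
      have "norm (r *\<^sub>R u) \<le> sqrt hbar \<longleftrightarrow> (norm (r *\<^sub>R u))\<^sup>2 \<le> hbar"
        by (subst real_sqrt_le_iff[symmetric]) simp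
      also have "\<dots> \<longleftrightarrow> (1/2) * (norm u)\<^sup>2 \<le> 1"
        using h by (simp add: power_mult_distrib r(3) field_simps)
      finally show ?thesis ..
    qed
    have Tu: "T *v u = block_diag B C *v (r *\<^sub>R u)" for u
      by (simp add: T_def matrix_scaleR_vector matrix_vector_mult_scaleR)
    show ?thesis
    proof (intro set_eqI iffI)
      fix z assume "z \<in> (\<lambda>z. block_diag B C *v z) ` cball 0 (sqrt hbar)"
      then obtain w where w: "z = block_diag B C *v w" "norm w \<le> sqrt hbar" by auto
      define u where "u = (1 / r) *\<^sub>R w"
      have "w = r *\<^sub>R u" using r by (simp add: u_def)
      with w have "z = T *v u" "norm (r *\<^sub>R u) \<le> sqrt hbar" by (simp_all only: Tu)
      then show "z \<in> {z. (1/2) * ((matrix_inv (covariance_matrix hbar \<psi>) *v z) \<bullet> z) \<le> 1}"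
        by (simp only: mem_Collect_eq q n)
    next
      fix z assume z: "z \<in> {z. (1/2) * ((matrix_inv (covariance_matrix hbar \<psi>) *v z) \<bullet> z) \<le> 1}"
      define u where "u = U *v z"
      have zu: "z = T *v u" by (simp add: u_def TUu)
      with z have "norm (r *\<^sub>R u) \<le> sqrt hbar" by (simp only: mem_Collect_eq q n)
      then show "z \<in> (\<lambda>z. block_diag B C *v z) ` cball 0 (sqrt hbar)"
        by (auto simp: zu Tu)
    qed
  qed
  moreover have "invertible (covariance_matrix hbar \<psi>)"
    unfolding cov by (rule matrix_inv_mult_transpose_quadratic[OF T0])
  ultimately show ?thesis
    by (simp add: is_covariance_ellipsoid_def LL flip: \<psi>_def)
qed

section \<open>Polar duality of ellipsoids and the assembly of the theorem\<close>

text \<open>Writing \<open>p = C *v q\<close> turns the pairing with \<open>B *v x\<close> into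
  \<open>q \<bullet> x\<close>, which reduces the claim to the self-duality of the ball of radius
  \<open>r\<close> at level \<open>r * r\<close>. One inclusion is Cauchy-Schwarz, the other tests
  with the multiple of \<open>q\<close> of length \<open>r\<close>.\<close>

lemma polar_dual_ellipsoid:
  fixes B C :: "real^'n::finite^'n"
  assumes BC: "transpose B ** C = mat 1" and "r > 0"
  shows "polar_dual (r * r) ((\<lambda>x. B *v x) ` cball 0 r) = (\<lambda>p. C *v p) ` cball 0 r"
proof -
  have CB: "(C *v p) \<bullet> (B *v x) = p \<bullet> x" for p x
    using BC by (metis inner_commute matrix_vector_mul_assoc matrix_vector_mul_lid transpose_mult_inner)
  have CtB: "C *v (transpose B *v p) = p" for p
    using BC by (metis matrix_left_right_inverse matrix_vector_mul_assoc matrix_vector_mul_lid)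
  show ?thesis
  proof (intro set_eqI iffI)
    fix p assume p: "p \<in> polar_dual (r * r) ((\<lambda>x. B *v x) ` cball 0 r)"
    define q where "q = transpose B *v p"
    have pq: "p = C *v q" by (simp only: q_def CtB)
    have *: "q \<bullet> x \<le> r * r" if "norm x \<le> r" for x
      using p that by (auto simp: polar_dual_def pq CB)
    have "norm q \<le> r"
    proof -
      have "norm (r *\<^sub>R sgn q) \<le> r" using assms(2) by (simp add: norm_sgn)
      moreover have "q \<bullet> (r *\<^sub>R sgn q) = r * norm q"
        by (cases "q = 0") (simp_all add: sgn_div_norm power2_norm_eq_inner[symmetric] power2_eq_square)
      ultimately have "r * norm q \<le> r * r" using *[of "r *\<^sub>R sgn q"] by metis
      then show ?thesis using assms(2) by simp
    qed
    then show "p \<in> (\<lambda>p. C *v p) ` cball 0 r" by (auto simp: pq)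
  next
    fix p assume "p \<in> (\<lambda>p. C *v p) ` cball 0 r"
    then obtain q where q: "p = C *v q" "norm q \<le> r" by auto
    have "q \<bullet> x \<le> r * r" if "norm x \<le> r" for x
      using norm_cauchy_schwarz[of q x] mult_mono[OF q(2) that] assms(2) by simp
    then show "p \<in> polar_dual (r * r) ((\<lambda>x. B *v x) ` cball 0 r)"
      by (auto simp: polar_dual_def q CB)
  qed
qed

text \<open>Hypothesis \<open>q\<close> makes \<open>B\<close> carry the Euclidean form to the form
  of \<open>A\<close>. The lemma serves both \<open>X\<close>, with \<open>A\<close> and
  \<open>B\<close>, and \<open>Xh\<close>, with \<open>matrix_inv A\<close> and
  \<open>C\<close>.\<close>

lemma ellipsoid_eq_image_cball:
  fixes A B :: "real^'n::finite^'n"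
  assumes h: "hbar \<ge> 0" and B: "invertible B" and q: "\<And>u. (A *v (B *v u)) \<bullet> (B *v u) = u \<bullet> u"
  shows "{x. (A *v x) \<bullet> x \<le> hbar} = (\<lambda>u. B *v u) ` cball 0 (sqrt hbar)"
proof -
  have n: "u \<bullet> u \<le> hbar \<longleftrightarrow> norm u \<le> sqrt hbar" for u :: "real^'n"
    by (simp add: norm_eq_sqrt_inner)
  show ?thesis
  proof (intro set_eqI iffI)
    fix x assume x: "x \<in> {x. (A *v x) \<bullet> x \<le> hbar}"
    define u where "u = matrix_inv B *v x"
    have xu: "x = B *v u"
      by (simp add: u_def matrix_vector_mul_assoc matrix_mult_inv_right[OF B])
    with x have "norm u \<le> sqrt hbar"
      by (simp only: mem_Collect_eq q n)
    then show "x \<in> (\<lambda>u. B *v u) ` cball 0 (sqrt hbar)"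
      by (simp add: xu)
  next
    fix x assume "x \<in> (\<lambda>u. B *v u) ` cball 0 (sqrt hbar)"
    then obtain u where "x = B *v u" "norm u \<le> sqrt hbar" by auto
    then show "x \<in> {x. (A *v x) \<bullet> x \<le> hbar}"
      by (simp only: mem_Collect_eq q n)
  qed
qed

theorem theorem12:
  fixes hbar :: real and A :: "real^'n::finite^'n" and X Xh :: "(real^'n) set"
  assumes hbar: "hbar > 0"
    and A: "positive_definite A"
    and X: "X = {x. (A *v x) \<bullet> x \<le> hbar}"
    and Xh: "Xh = {p. (matrix_inv A *v p) \<bullet> p \<le> hbar}"
  shows "Xh = polar_dual hbar X \<and>
    convex (phase_product X Xh) \<and>
    (\<exists>!\<Omega>. quantum_blob hbar \<Omega> \<and> \<Omega> \<subseteq> phase_product X Xh \<and>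
       pos_proj ` \<Omega> = X \<and> mom_proj ` \<Omega> = Xh) \<and>
    (\<forall>\<Omega>. quantum_blob hbar \<Omega> \<and> \<Omega> \<subseteq> phase_product X Xh \<and>
       pos_proj ` \<Omega> = X \<and> mom_proj ` \<Omega> = Xh \<longrightarrow>
       largest_inscribed_ellipsoid (phase_product X Xh) \<Omega> \<and>
       is_covariance_ellipsoid hbar (gaussian_state ((hbar / 2) *\<^sub>R matrix_inv A)) \<Omega>)"
proof -
  obtain B :: "real^'n^'n" where B: "transpose B ** A ** B = mat 1"
    by (rule positive_definite_factor[OF A])
  \<comment> \<open>\<open>C\<close> is the inverse transpose of \<open>B\<close>, the momentum
    block that makes \<open>block_diag B C\<close> symplectic.\<close>
  define C where "C = A ** B"
  have BC: "transpose B ** C = mat 1"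
    using B by (simp add: C_def matrix_mul_assoc)
  have CB: "C ** transpose B = mat 1"
    using BC matrix_left_right_inverse by blast
  have "B ** transpose C = mat 1"
    using arg_cong[OF CB, of transpose] by (simp add: matrix_transpose_mul)
  then have iB: "invertible B" by (rule matrix_inv_eqI)
  from CB have iC: "invertible C" by (rule matrix_inv_eqI)
  have invA: "matrix_inv A = B ** transpose B"
    using CB by (intro matrix_inv_eqI) (simp add: C_def matrix_mul_assoc)
  have BCi: "(B *v x) \<bullet> (C *v y) = x \<bullet> y" for x y
    using BC by (metis inner_commute matrix_vector_mul_assoc matrix_vector_mul_lid transpose_mult_inner)
  have X_eq: "X = (\<lambda>u. B *v u) ` cball 0 (sqrt hbar)"
    unfolding X
  proof (rule ellipsoid_eq_image_cball[OF _ iB])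
    show "(A *v (B *v u)) \<bullet> (B *v u) = u \<bullet> u" for u
      using BCi[of u u] by (simp add: C_def matrix_vector_mul_assoc inner_commute)
  qed (use hbar in simp)
  have Xh_eq: "Xh = (\<lambda>u. C *v u) ` cball 0 (sqrt hbar)"
    unfolding Xh
  proof (rule ellipsoid_eq_image_cball[OF _ iC])
    fix u
    have "matrix_inv A *v (C *v u) = B *v u"
      unfolding invA using BC by (metis matrix_mul_assoc matrix_mul_rid matrix_vector_mul_assoc)
    then show "(matrix_inv A *v (C *v u)) \<bullet> (C *v u) = u \<bullet> u"
      by (simp add: BCi)
  qed (use hbar in simp)
  define S where "S = block_diag B C"
  have S: "S \<in> Sp" unfolding S_def by (rule block_diag_in_Sp[OF BC])
  define \<Omega> where "\<Omega> = (\<lambda>z. S *v z) ` cball 0 (sqrt hbar)"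
  \<comment> \<open>The product \<open>X \<times> Xh\<close> in the coordinates given by
    \<open>?T\<close>: a product of two unit balls.\<close>
  define Q where "Q = {w :: real^('n + 'n). norm (pos_proj w) \<le> 1 \<and> norm (mom_proj w) \<le> 1}"
  let ?T = "sqrt hbar *\<^sub>R S"
  have iS: "invertible S"
    using abs_det_Sp[OF S] by (auto simp: invertible_det_nz)
  then have iT: "invertible ?T" using hbar by (simp add: invertible_scaleR)
  have prod_eq: "phase_product X Xh = (\<lambda>z. ?T *v z) ` Q"
  proof (intro set_eqI iffI)
    fix z assume "z \<in> phase_product X Xh"
    then obtain u v where uv: "pos_proj z = B *v u" "norm u \<le> sqrt hbar" "mom_proj z = C *v v" "norm v \<le> sqrt hbar"
      by (auto simp: phase_product_def X_eq Xh_eq)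
    define w where "w = (1 / sqrt hbar) *\<^sub>R phase_pair u v"
    have "w \<in> Q" using uv hbar by (simp add: Q_def w_def)
    moreover have "z = ?T *v w"
      using uv hbar by (intro phase_eqI) (simp_all add: w_def S_def matrix_scaleR_vector matrix_vector_mult_scaleR)
    ultimately show "z \<in> (\<lambda>z. ?T *v z) ` Q" by blast
  next
    fix z assume "z \<in> (\<lambda>z. ?T *v z) ` Q"
    then obtain w where "w \<in> Q" and z: "z = ?T *v w" by auto
    then have "norm (sqrt hbar *\<^sub>R pos_proj w) \<le> sqrt hbar" "norm (sqrt hbar *\<^sub>R mom_proj w) \<le> sqrt hbar"
      using hbar by (simp_all add: Q_def mult_left_le)
    moreover have "pos_proj z = B *v (sqrt hbar *\<^sub>R pos_proj w)" "mom_proj z = C *v (sqrt hbar *\<^sub>R mom_proj w)"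
      by (simp_all add: z S_def matrix_scaleR_vector matrix_vector_mult_scaleR)
    ultimately show "z \<in> phase_product X Xh"
      by (auto simp: phase_product_def X_eq Xh_eq)
  qed
  have \<Omega>_eq: "\<Omega> = (\<lambda>z. ?T *v z) ` cball 0 1"
    unfolding \<Omega>_def using hbar by (intro image_matrix_cball_scaleR) simp
  have proj_le: "norm (pos_proj w) \<le> norm w" "norm (mom_proj w) \<le> norm w" for w :: "real^('n + 'n)"
    using norm_phase[of w] by (simp_all add: power2_le_imp_le)
  have largest: "largest_inscribed_ellipsoid (phase_product X Xh) \<Omega>"
    unfolding prod_eq \<Omega>_eq
  proof (rule largest_inscribed_ellipsoid_linear_image[OF iT])
    show "cball 0 1 \<subseteq> Q"
      using order_trans[OF proj_le(1)] order_trans[OF proj_le(2)] by (simp add: Q_def subset_iff)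
    show "\<bar>w $ i\<bar> \<le> 1" if "w \<in> Q" for w i
    proof (cases i)
      case (Inl a)
      then show ?thesis
        using that component_le_norm_cart[of "pos_proj w" a] by (simp add: Q_def pos_proj_def)
    next
      case (Inr a)
      then show ?thesis
        using that component_le_norm_cart[of "mom_proj w" a] by (simp add: Q_def mom_proj_def)
    qed
  qed
  have "(quantum_blob hbar \<Omega> \<and> \<Omega> \<subseteq> phase_product X Xh) \<and>
      pos_proj ` \<Omega> = X \<and> mom_proj ` \<Omega> = Xh"
  proof (intro conjI)
    show blob: "quantum_blob hbar \<Omega>"
      using S by (auto simp: quantum_blob_def \<Omega>_def)
    show sub: "\<Omega> \<subseteq> phase_product X Xh"
      using largest by (simp add: largest_inscribed_ellipsoid_def)
    show "pos_proj ` \<Omega> = X"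
    proof
      show "pos_proj ` \<Omega> \<subseteq> X" using sub by (auto simp: phase_product_def)
      show "X \<subseteq> pos_proj ` \<Omega>"
      proof
        fix x assume "x \<in> X"
        then obtain u where u: "x = B *v u" "norm u \<le> sqrt hbar" by (auto simp: X_eq)
        \<comment> \<open>The preimage is taken with zero momentum, so that its norm is that of
          \<open>u\<close> and it stays in the ball.\<close>
        have "(norm (phase_pair u 0))\<^sup>2 = (norm u)\<^sup>2" by (subst norm_phase) simp
        then have "norm (phase_pair u 0) = norm u" by (rule power2_eq_imp_eq) simp_all
        then have "S *v phase_pair u 0 \<in> \<Omega>" using u by (simp add: \<Omega>_def)
        moreover have "x = pos_proj (S *v phase_pair u 0)" by (simp add: S_def u)
        ultimately show "x \<in> pos_proj ` \<Omega>" by (rule rev_image_eqI)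
      qed
    qed
    show "mom_proj ` \<Omega> = Xh"
    proof
      show "mom_proj ` \<Omega> \<subseteq> Xh" using sub by (auto simp: phase_product_def)
      show "Xh \<subseteq> mom_proj ` \<Omega>"
      proof
        fix x assume "x \<in> Xh"
        then obtain u where u: "x = C *v u" "norm u \<le> sqrt hbar" by (auto simp: Xh_eq)
        have "(norm (phase_pair 0 u))\<^sup>2 = (norm u)\<^sup>2" by (subst norm_phase) simp
        then have "norm (phase_pair 0 u) = norm u" by (rule power2_eq_imp_eq) simp_all
        then have "S *v phase_pair 0 u \<in> \<Omega>" using u by (simp add: \<Omega>_def)
        moreover have "x = mom_proj (S *v phase_pair 0 u)" by (simp add: S_def u)
        ultimately show "x \<in> mom_proj ` \<Omega>" by (rule rev_image_eqI)
      qed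
    qed
  qed
  then have \<Omega>: "quantum_blob hbar \<Omega>" "\<Omega> \<subseteq> phase_product X Xh" "pos_proj ` \<Omega> = X" "mom_proj ` \<Omega> = Xh"
    by auto
  \<comment> \<open>Quantum blobs all have the same volume, so the strictly largest ellipsoid is the only one.\<close>
  have unique: "\<Omega>' = \<Omega>" if "quantum_blob hbar \<Omega>'" "\<Omega>' \<subseteq> phase_product X Xh" for \<Omega>'
  proof (rule ccontr)
    assume "\<Omega>' \<noteq> \<Omega>"
    then have "measure lebesgue \<Omega>' < measure lebesgue \<Omega>"
      using largest that quantum_blob_ellipsoid(1)[OF hbar that(1)]
      by (simp add: largest_inscribed_ellipsoid_def)
    then show False
      using quantum_blob_ellipsoid(2)[OF hbar that(1)] quantum_blob_ellipsoid(2)[OF hbar \<Omega>(1)] by simp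
  qed
  have "is_covariance_ellipsoid hbar (gaussian_state ((hbar / 2) *\<^sub>R matrix_inv A)) \<Omega>"
    unfolding invA \<Omega>_def S_def by (rule covariance_ellipsoid_gaussian_state[OF hbar BC])
  moreover have "Xh = polar_dual hbar X"
    using polar_dual_ellipsoid[OF BC, of "sqrt hbar"] hbar by (simp add: X_eq Xh_eq)
  moreover have "convex (phase_product X Xh)"
  proof -
    have "phase_product X Xh = pos_proj -` X \<inter> mom_proj -` Xh"
      by (auto simp: phase_product_def)
    moreover have "linear (pos_proj :: real^('n + 'n) \<Rightarrow> real^'n)" "linear (mom_proj :: real^('n + 'n) \<Rightarrow> real^'n)"
      by (auto intro!: linearI simp: pos_proj_def mom_proj_def vec_eq_iff)
    ultimately show ?thesis
      by (simp add: X_eq Xh_eq convex_Int convex_linear_vimage convex_linear_image)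
  qed
  moreover have "\<exists>!\<Omega>. quantum_blob hbar \<Omega> \<and> \<Omega> \<subseteq> phase_product X Xh \<and>
       pos_proj ` \<Omega> = X \<and> mom_proj ` \<Omega> = Xh"
  proof (rule ex1I[of _ \<Omega>])
    show "quantum_blob hbar \<Omega> \<and> \<Omega> \<subseteq> phase_product X Xh \<and> pos_proj ` \<Omega> = X \<and> mom_proj ` \<Omega> = Xh"
      using \<Omega> by simp
  qed (use unique in simp)
  \<comment> \<open>Lets the properties proved for \<open>\<Omega>\<close> pass to any blob over
    which the last conjunct quantifies.\<close>
  moreover have "\<forall>\<Omega>'. quantum_blob hbar \<Omega>' \<and> \<Omega>' \<subseteq> phase_product X Xh \<and>
      pos_proj ` \<Omega>' = X \<and> mom_proj ` \<Omega>' = Xh \<longrightarrow> \<Omega>' = \<Omega>"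
    using unique by simp
  ultimately show ?thesis
    using largest by metis
qed

end
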